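(* Let $\nu$ be a probability measure on $[0,\infty)$ with unbounded support and with all positive moments finite. (1) Suppose that there exists $G_*\in\mathscr{A}_{\mathscr{D}}$ such that either $$\overline{\nu}(x)=O\left(e^{-G_*(\log x)}\right)\quad (x\to\infty),$$ or $\nu(dx)=\nu(x)\,dx$ is absolutely continuous with $$\nu(x)=O\left(e^{-G_*(\log x)}\right)\quad (x\to\infty).$$ Then, writing $\overleftarrow{G_*'}$ for the inverse of the continuous and increasing function $G_*'$, $$\sum^\infty e^{-\frac{1}{2}\overleftarrow{G_*'}(n)}=\infty\ \Longrightarrow\ \nu\text{ is moment determinate}.$$ (2) If in addition $\nu(dx)=\nu(x)\,dx$ with $$\nu(x)\asymp e^{-G_*(\log x)}\quad (x\to\infty)$$ and $\lim_{x\to\infty}G_*'(x)e^{-x/2}<\infty$ (the limit exists and is finite), then the following are equivalent: (i) $\nu$ is moment indeterminate; (ii) $\sum^\infty e^{-\frac{1}{2}\overleftarrow{G_*'}(n)}<\infty$; (iii) $\int^\infty G_*(x)e^{-x/2}\,dx<\infty$; (iv) $\int^\infty\frac{-\log\nu(x^2)}{1+x^2}\,dx<\infty$.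
   Context: A positive measure on $[0,\infty)$ with all moments of order $n=0,1,2,\dots$ finite is called moment determinate if it is the only positive measure on $[0,\infty)$ with these moments (Stieltjes moment problem), and moment indeterminate otherwise. $\overline{\nu}(x)=\int_x^\infty\nu(dy)$ denotes the tail of $\nu$; when $\nu$ is absolutely continuous its density is also denoted $\nu(x)$. For an interval $I\subseteq\mathbb{R}$, $C^2_+(I)$ denotes the set of twice differentiable functions on $I$ whose second derivative is continuous and strictly positive on $I$. The set $\mathscr{A}$ of asymptotically parabolic functions is the set of all $G\in C_+^2((a,\infty))$, for some $a\ge-\infty$, such that $$\lim_{u\to\infty}\frac{G''\left(u+w\,(G''(u))^{-1/2}\right)}{G''(u)}=1\quad\text{locally uniformly in } w\in\mathbb{R}.$$ The set of admissible asymptotically parabolic functions is $\mathscr{A}_{\mathscr{D}}=\{G_*\in\mathscr{A}:\ \lim_{x\to\infty}G_*(x)/x=\infty\}$. $f(x)=O(g(x))$ as $x\to\infty$ means $\limsup_{x\to\infty}|f(x)/g(x)|<\infty$; $f(x)\asymp g(x)$ means $f(x)=O(g(x))$ and $g(x)=O(f(x))$ as $x\to\infty$. The notation $\int^\infty$ means $\int_A^\infty$ for some sufficiently large $A>0$, and $\sum^\infty$ means the sum over integers $n\ge N$ for some sufficiently large $N\geq 1$. *)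

theory Defs
  imports "HOL-Probability.Probability"
begin

text \<open>
  A positive measure on the half-line $[0,\infty)$ is represented by a Borel measure on the real
  line that gives no mass to the negative numbers.  Since the moments of order \<open>n = 0, 1, 2, \<dots>\<close>
  are finite, such a measure is finite and has finite moments of every real order \<open>p \<ge> 0\<close>.
\<close>

definition half_line_measure :: "real measure \<Rightarrow> bool" where
  "half_line_measure \<mu> \<longleftrightarrow> sets \<mu> = sets borel \<and> emeasure \<mu> {..<0} = 0"

definition finite_moments :: "real measure \<Rightarrow> bool" where
  "finite_moments \<mu> \<longleftrightarrow> (\<forall>n::nat. integrable \<mu> (\<lambda>x. x ^ n))"

text \<open>
  The next two notions are meant for half-line measures \<open>\<nu>\<close> with finite moments.  The competitors
  \<open>\<mu>\<close> are required to have finite moments explicitly, because the Bochner integral of a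
  non-integrable function is \<open>0\<close>.
\<close>

definition moment_determinate :: "real measure \<Rightarrow> bool" where
  "moment_determinate \<nu> \<longleftrightarrow>
     (\<forall>\<mu>. half_line_measure \<mu> \<and> finite_moments \<mu> \<and>
          (\<forall>n::nat. (\<integral>x. x ^ n \<partial>\<mu>) = (\<integral>x. x ^ n \<partial>\<nu>)) \<longrightarrow> \<mu> = \<nu>)"

definition moment_indeterminate :: "real measure \<Rightarrow> bool" where
  "moment_indeterminate \<nu> \<longleftrightarrow> \<not> moment_determinate \<nu>"

definition measure_support :: "real measure \<Rightarrow> real set" where
  "measure_support \<nu> = {x. \<forall>U. open U \<and> x \<in> U \<longrightarrow> 0 < emeasure \<nu> U}"

definition measure_tail :: "real measure \<Rightarrow> real \<Rightarrow> real" where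
  "measure_tail \<nu> x = measure \<nu> {x..}"

definition is_density :: "real measure \<Rightarrow> (real \<Rightarrow> real) \<Rightarrow> bool" where
  "is_density \<nu> f \<longleftrightarrow> f \<in> borel_measurable borel \<and> (\<forall>x. 0 \<le> f x) \<and>
     \<nu> = density lborel (\<lambda>x. ennreal (f x))"

text \<open>
  A function on \<open>I\<close> is represented by a total function of which only the values on \<open>I\<close> matter.
  With \<^const>\<open>deriv\<close> this is adequate for open \<open>I\<close> only, which is the only case used.
\<close>

definition C2_plus :: "real set \<Rightarrow> (real \<Rightarrow> real) set" where
  "C2_plus I = {G. (\<forall>x\<in>I. G differentiable at x) \<and> (\<forall>x\<in>I. deriv G differentiable at x) \<and>
                   continuous_on I (deriv (deriv G)) \<and> (\<forall>x\<in>I. 0 < deriv (deriv G) x)}"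

definition ray :: "ereal \<Rightarrow> real set" where
  "ray a = {x. a < ereal x}"

text \<open>
  The left end point \<open>a\<close> of the domain of \<open>G\<close> is kept as a parameter.  The third conjunct says that
  the quotient in the limit is eventually defined, locally uniformly in \<open>w\<close>; the values of the
  total function \<open>G\<close> outside its domain therefore play no role.
\<close>

definition asymptotically_parabolic :: "ereal \<Rightarrow> (real \<Rightarrow> real) \<Rightarrow> bool" where
  "asymptotically_parabolic a G \<longleftrightarrow>
     a < \<infinity> \<and> G \<in> C2_plus (ray a) \<and>
     (\<forall>K. compact K \<longrightarrow>
        (\<forall>\<^sub>F u in at_top. \<forall>w\<in>K. u + w * deriv (deriv G) u powr (-1/2) \<in> ray a)) \<and>
     (\<forall>K. compact K \<longrightarrow>
        uniform_limit K
          (\<lambda>u w. deriv (deriv G) (u + w * deriv (deriv G) u powr (-1/2)) / deriv (deriv G) u)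
          (\<lambda>w. 1) at_top)"

definition admissible_parabolic :: "ereal \<Rightarrow> (real \<Rightarrow> real) \<Rightarrow> bool" where
  "admissible_parabolic a G \<longleftrightarrow>
     asymptotically_parabolic a G \<and> filterlim (\<lambda>x. G x / x) at_top at_top"

text \<open>
  The inverse of the derivative \<open>G' : (a,\<infinity>) \<rightarrow> \<real>\<close>.  For admissible \<open>G\<close> the range of \<open>G'\<close> contains
  all sufficiently large reals; the value at points outside the range is unspecified.
\<close>

definition deriv_inverse :: "ereal \<Rightarrow> (real \<Rightarrow> real) \<Rightarrow> real \<Rightarrow> real" where
  "deriv_inverse a G = the_inv_into (ray a) (deriv G)"

text \<open>
  Finiteness of the integral of \<open>f\<close> near infinity, for \<open>f\<close> eventually nonnegative.
\<close>

definition finite_integral_at_top :: "(real \<Rightarrow> real) \<Rightarrow> bool" where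
  "finite_integral_at_top f \<longleftrightarrow> (\<forall>\<^sub>F A in at_top. set_integrable lborel {A..} f)"

text \<open>
  Finiteness of the sum of \<open>f n\<close> over all sufficiently large integers \<open>n\<close>, for nonnegative \<open>f\<close>;
  finitely many terms of \<open>f\<close> may be unspecified.
\<close>

definition finite_sum_at_top :: "(nat \<Rightarrow> real) \<Rightarrow> bool" where
  "finite_sum_at_top f \<longleftrightarrow> (\<forall>\<^sub>F N in sequentially. summable (\<lambda>n. f (n + N)))"

end

theory Submission
  imports Defs "HOL-Complex_Analysis.Complex_Analysis"
begin

text \<open>
  Determinacy: with $L$ the Legendre transform of $G$ one has $m_n \le C e^{n + L(n+N)}$, and
  $L' = \overleftarrow{G'}$.  A difference of the characteristic functions of two symmetrised
  solutions has all derivatives zero at $0$ and derivatives bounded by a log-convex sequence $M_k$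
  with $M_k/M_{k+1} \ge e^{-1} e^{-\overleftarrow{G'}(k/2+c)/2}$.  If the series diverges, Bang's
  proof of the Denjoy-Carleman theorem shows that the difference is zero.

  Indeterminacy: if the series converges, its terms can serve as the $b_k$ in
  $P(y) = \prod_k (\sin(b_k y)/(b_k y))^2$, which decays like $e^{-G(\log y^2)}$.  For
  $c \ge 2\sum_k b_k$ all integrals $\int y^m \cos(cy) P(y)\,dy$ vanish (shift the contour into the
  upper half-plane), so that $\sqrt{x}\cos(c\sqrt{x})P(\sqrt{x})$, translated and scaled, is a
  perturbation of the density that does not change any moment.

  The equivalence of the series with the integrals is Tonelli's theorem, because
  $G(u)$ is $\sum_n (u - \overleftarrow{G'}(n))^+$ up to a linear term and
  $\int_v^\infty (u-v) e^{-u/2}\,du = 4 e^{-v/2}$.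
\<close>

section \<open>Bang's proof of the Denjoy-Carleman theorem\<close>

text \<open>The factor 1/2 in the exponent of the series comes from symmetrisation: the absolute
  moment of order k of a randomly signed square root is a moment of order k/2, so Bang's argument
  advances the Legendre transform in half-unit steps, each costing at most \<open>v / 2\<close>. The
  same numbers serve the converse because a factor \<open>(sinc (b * y))\<^sup>2\<close> is at most
  1 and at most \<open>inverse ((b * y)\<^sup>2)\<close>. With \<open>b = exp (- v / 2)\<close> the
  better of the two bounds is the exponential of minus the positive part of
  \<open>ln (y\<^sup>2) - v\<close>. Each factor has exponential type \<open>2 * b\<close>, so
  convergence of the series gives the product a finite type, and a cosine of at least that frequency
  moves frequency 0 to a point where the Fourier transform vanishes to all orders. The factor
  \<open>sqrt x\<close> and the Jacobian of \<open>x = y\<^sup>2\<close> together make the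
  substituted integrand even, which extends the half-line integral to the line. The translation is
  forced because the density is bounded below only for large arguments, while the perturbation has
  to stay below it everywhere.\<close>

lemma denjoy_carleman_step:
  fixes D :: "nat \<Rightarrow> real \<Rightarrow> complex" and M :: "nat \<Rightarrow> real"
  assumes pos: "\<And>k. 0 < M k"
    and ratio: "incseq (\<lambda>k. M (Suc k) / M k)"
    and bound: "\<And>k x. cmod (D k x) \<le> M k"
    and taylor: "\<And>j n x h. cmod (D j (x + h) - (\<Sum>i<n. D (j + i) x * h ^ i / fact i))
                   \<le> M (j + n) * \<bar>h\<bar> ^ n / fact n"
    and b: "exp (- real (Suc N)) \<le> b" "\<And>j. cmod (D j x) \<le> b * exp (real j) * M j"
  shows "cmod (D j (x + h)) \<le> b * exp (exp 1 * \<bar>h\<bar> * (M (Suc N) / M N)) * exp (real j) * M j"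
proof -
  define r where "r = M (Suc N) / M N"
  have r0: "0 < r" using pos by (simp add: r_def)
  have b0: "0 < b" using b(1) by (smt (verit) exp_gt_zero)
  \<comment> \<open>Log-convexity: all ratios with index up to \<open>N\<close> are at most the last
    one, \<open>r\<close>.\<close>
  have M_le: "M (j + i) \<le> M j * r ^ i" if "j + i \<le> Suc N" for i
    using that
  proof (induction i)
    case (Suc i)
    have "M (Suc (j + i)) / M (j + i) \<le> r"
      unfolding r_def using incseqD[OF ratio, of "j + i" N] Suc.prems by simp
    hence "M (Suc (j + i)) \<le> r * M (j + i)"
      using pos by (simp add: divide_le_eq)
    also have "\<dots> \<le> r * (M j * r ^ i)"
      using Suc r0 by (intro mult_left_mono) auto
    finally show ?case by (simp add: algebra_simps)
  qed simp
  show ?thesis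
  proof (cases "j \<le> N")
    case True
    \<comment> \<open>The expansion stops at the derivative of order \<open>N + 1\<close>, where the
      weight \<open>b * exp (N + 1)\<close> is at least 1, so that the a priori bound by
      \<open>M\<close> is already as good as the weighted one.\<close>
    define n where "n = Suc N - j"
    have jn: "j + n = Suc N" using True by (simp add: n_def)
    \<comment> \<open>Raising the order by one costs a factor \<open>r\<close> from \<open>M\<close>
      and a factor e from the weight, so the Taylor terms are dominated by those of
      \<open>exp z\<close>.\<close>
    define z where "z = exp 1 * \<bar>h\<bar> * r"
    have z0: "0 \<le> z" using r0 by (simp add: z_def)
    have term_le: "b * exp (real (j + i)) * M (j + i) * \<bar>h\<bar> ^ i / fact i
        \<le> b * exp (real j) * M j * (z ^ i / fact i)" if "i \<le> n" for i
    proof -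
      have "b * exp (real (j + i)) * M (j + i) * \<bar>h\<bar> ^ i / fact i
          \<le> b * exp (real (j + i)) * (M j * r ^ i) * \<bar>h\<bar> ^ i / fact i"
        using that jn b0 by (intro divide_right_mono mult_right_mono mult_left_mono M_le) auto
      also have "\<dots> = b * exp (real j) * M j * (z ^ i / fact i)"
        by (simp add: z_def power_mult_distrib exp_add exp_of_nat_mult[symmetric] mult_ac)
      finally show ?thesis .
    qed
    have "cmod (D j (x + h)) \<le> cmod (\<Sum>i<n. D (j + i) x * h ^ i / fact i) + M (j + n) * \<bar>h\<bar> ^ n / fact n"
      using taylor[of j x h n] norm_triangle_sub[of "D j (x + h)"] by (smt (verit))
    also have "M (j + n) * \<bar>h\<bar> ^ n / fact n \<le> b * exp (real (j + n)) * M (j + n) * \<bar>h\<bar> ^ n / fact n"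
    proof -
      have "1 = exp (- real (Suc N)) * exp (real (j + n))"
        unfolding jn by (simp add: mult_exp_exp)
      also have "\<dots> \<le> b * exp (real (j + n))"
        by (intro mult_right_mono b) auto
      finally have "1 * M (j + n) \<le> b * exp (real (j + n)) * M (j + n)"
        using pos less_imp_le by (intro mult_right_mono) auto
      thus ?thesis by (intro divide_right_mono mult_right_mono) auto
    qed
    also have "\<dots> \<le> b * exp (real j) * M j * (z ^ n / fact n)"
      by (rule term_le) simp
    also have "cmod (\<Sum>i<n. D (j + i) x * h ^ i / fact i) \<le> (\<Sum>i<n. b * exp (real j) * M j * (z ^ i / fact i))"
    proof (rule sum_norm_le)
      fix i assume i: "i \<in> {..<n}"
      have "cmod (D (j + i) x * h ^ i / fact i) \<le> b * exp (real (j + i)) * M (j + i) * \<bar>h\<bar> ^ i / fact i"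
        using b(2)[of "j + i"]
        by (simp add: norm_mult norm_divide norm_power divide_right_mono mult_right_mono)
      also have "\<dots> \<le> b * exp (real j) * M j * (z ^ i / fact i)"
        using i by (intro term_le) auto
      finally show "cmod (D (j + i) x * h ^ i / fact i) \<le> b * exp (real j) * M j * (z ^ i / fact i)" .
    qed
    also have "(\<Sum>i<n. b * exp (real j) * M j * (z ^ i / fact i)) + b * exp (real j) * M j * (z ^ n / fact n)
        = b * exp (real j) * M j * (\<Sum>i<Suc n. z ^ i / fact i)"
      by (simp add: sum_distrib_left algebra_simps)
    also have "\<dots> \<le> b * exp (real j) * M j * exp z"
    proof (intro mult_left_mono)
      show "(\<Sum>i<Suc n. z ^ i / fact i) \<le> exp z"
        unfolding exp_def using summable_exp_generic[of z] z0
        by (intro order_trans[OF sum_le_suminf]) (auto simp: scaleR_conv_of_real divide_inverse mult.commute)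
    qed (use b0 pos[of j] in auto)
    finally show ?thesis by (simp add: z_def r_def mult_ac)
  next
    case False
    \<comment> \<open>Beyond order \<open>N\<close> the weight \<open>b * exp j\<close> is at least
      1 and the a priori bound is enough.\<close>
    have "cmod (D j (x + h)) \<le> 1 * M j" using bound by simp
    also have "\<dots> \<le> (b * exp (exp 1 * \<bar>h\<bar> * r) * exp (real j)) * M j"
    proof (intro mult_right_mono)
      have "1 = exp (- real (Suc N)) * 1 * exp (real (Suc N))" by (simp add: mult_exp_exp)
      also have "\<dots> \<le> b * exp (exp 1 * \<bar>h\<bar> * r) * exp (real j)"
        using False r0 b0 b(1) by (intro mult_mono) auto
      finally show "1 \<le> b * exp (exp 1 * \<bar>h\<bar> * r) * exp (real j)" .
    qed (use pos[of j] in auto)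
    finally show ?thesis by (simp add: r_def)
  qed
qed

lemma not_summable_sum_unbounded:
  fixes f :: "nat \<Rightarrow> real"
  assumes "\<And>n. 0 \<le> f n" "\<not> summable f"
  shows "\<exists>K\<ge>N. t \<le> (\<Sum>k=N..<K. f k)"
proof (rule ccontr)
  assume *: "\<not> ?thesis"
  have "sum f {..<n} \<le> sum f {..<N} + t" for n
  proof (cases "N \<le> n")
    case True
    hence "sum f {..<n} = sum f {..<N} + sum f {N..<n}"
      by (metis lessThan_atLeast0 sum.atLeastLessThan_concat zero_le)
    thus ?thesis using * True by force
  next
    case False
    hence "sum f {..<n} \<le> sum f {..<N}" using assms by (intro sum_mono2) auto
    moreover have "0 \<le> t" using * by force
    ultimately show ?thesis by simp
  qed
  hence "summable f" using assms(1) by (intro summableI_nonneg_bounded)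
  thus False using assms by simp
qed

text \<open>
  By \<open>denjoy_carleman_step\<close>, raising the weighted bound from $e^{-(N+1)}$ to $e^{-N}$ requires moving a
  distance of at least $M_N/(e M_{N+1})$; starting at $0$, where all derivatives vanish, no finite
  distance therefore suffices to leave the level $e^{-N}$.
\<close>

lemma denjoy_carleman_vanishing:
  fixes D :: "nat \<Rightarrow> real \<Rightarrow> complex" and M :: "nat \<Rightarrow> real"
  assumes pos: "\<And>k. 0 < M k"
    and ratio: "incseq (\<lambda>k. M (Suc k) / M k)"
    and bound: "\<And>k x. cmod (D k x) \<le> M k"
    and taylor: "\<And>j n x h. cmod (D j (x + h) - (\<Sum>i<n. D (j + i) x * h ^ i / fact i))
                   \<le> M (j + n) * \<bar>h\<bar> ^ n / fact n"
    and zero: "\<And>k. D k 0 = 0"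
    and div: "\<not> summable (\<lambda>k. M k / M (Suc k))"
  shows "D 0 x = 0"
proof -
  define s where "s k = M k / M (Suc k) / exp 1" for k
  have s0: "0 < s k" for k using pos by (simp add: s_def)
  \<comment> \<open>Downward induction on the level: at \<open>N = K\<close> the interval is the
    single point 0, and each step down enlarges it by \<open>s N\<close>, over which the exponential
    in the step lemma grows to at most e.\<close>
  have close: "cmod (D j y) \<le> exp (- real N) * exp (real j) * M j"
    if "N \<le> K" "\<bar>y\<bar> \<le> (\<Sum>k=N..<K. s k)" for N K j y
    using that
  proof (induction N arbitrary: y j rule: inc_induct)
    case base
    thus ?case using zero less_imp_le[OF pos[of j]] by simp
  next
    case (step N)
    define d where "d = (\<Sum>k=Suc N..<K. s k)"
    have d0: "0 \<le> d" unfolding d_def using s0 less_imp_le by (intro sum_nonneg) auto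
    have y: "\<bar>y\<bar> \<le> s N + d" using step by (simp add: d_def sum.atLeast_Suc_lessThan)
    \<comment> \<open>The point nearest to \<open>y\<close> in the interval where the better level
      is already known.\<close>
    define x where "x = max (-d) (min d y)"
    have x: "\<bar>x\<bar> \<le> d" "\<bar>y - x\<bar> \<le> s N" using y d0 s0[of N] by (auto simp: x_def)
    have "cmod (D j (x + (y - x))) \<le>
        exp (- real (Suc N)) * exp (exp 1 * \<bar>y - x\<bar> * (M (Suc N) / M N)) * exp (real j) * M j"
      using step.IH x(1) unfolding d_def
      by (intro denjoy_carleman_step[OF pos ratio bound taylor]) auto
    also have "\<dots> \<le> exp (- real (Suc N)) * exp (exp 1 * s N * (M (Suc N) / M N)) * exp (real j) * M j"
      using x(2) less_imp_le[OF pos] by (intro mult_right_mono mult_left_mono iffD2[OF exp_le_cancel_iff] divide_nonneg_nonneg) auto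
    also have "exp 1 * s N * (M (Suc N) / M N) = 1"
      using pos[of N] pos[of "Suc N"] by (simp add: s_def field_simps)
    finally show ?case by (simp add: exp_diff exp_minus exp_add field_simps)
  qed
  have "\<not> summable s"
    using div summable_mult[of s "exp 1"] by (auto simp: s_def)
  \<comment> \<open>Divergence of every tail brings the fixed point \<open>x\<close> within reach of
    each level.\<close>
  have "cmod (D 0 x) \<le> exp (- real N) * M 0" for N
    using not_summable_sum_unbounded[of s N "\<bar>x\<bar>"] \<open>\<not> summable s\<close> close[of N _ x 0] less_imp_le[OF s0] by auto
  moreover have "(\<lambda>N. exp (- real N) * M 0) \<longlonglongrightarrow> 0"
    by real_asymp
  ultimately have "cmod (D 0 x) \<le> 0"
    by (intro LIMSEQ_le_const[of "\<lambda>N. exp (- real N) * M 0"]) auto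
  thus ?thesis by simp
qed

section \<open>Uniqueness in the Hamburger moment problem\<close>

text \<open>\<open>D k\<close> is the k-th derivative of the characteristic function, written as an
  integral, so that its Taylor estimate is the integrated estimate for the exponential.\<close>

lemma char_taylor:
  fixes \<rho> :: "real measure" and D :: "nat \<Rightarrow> real \<Rightarrow> complex" and t h :: real and j n k :: nat
  assumes "real_distribution \<rho>" and int: "\<And>k. integrable \<rho> (\<lambda>y. \<bar>y\<bar> ^ k)"
    and D_def: "\<And>k t. D k t = (CLINT y|\<rho>. (\<i> * y) ^ k * iexp (t * y))"
  shows "cmod (D k t) \<le> (\<integral>y. \<bar>y\<bar> ^ k \<partial>\<rho>)"
    and "cmod (D j (t + h) - (\<Sum>i<n. D (j + i) t * h ^ i / fact i))
          \<le> (\<integral>y. \<bar>y\<bar> ^ (j + n) \<partial>\<rho>) * \<bar>h\<bar> ^ n / fact n"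
proof -
  interpret real_distribution \<rho> by fact
  have ints: "integrable \<rho> (\<lambda>y. (\<i> * y) ^ k * iexp (t * y))" for k t
    by (rule Bochner_Integration.integrable_bound[OF int[of k]]) (auto simp: norm_mult norm_power)
  show "cmod (D k t) \<le> (\<integral>y. \<bar>y\<bar> ^ k \<partial>\<rho>)"
    unfolding D_def
    by (rule order_trans[OF integral_norm_bound]) (auto simp: norm_mult norm_power)
  have "D j (t + h) - (\<Sum>i<n. D (j + i) t * h ^ i / fact i) =
      (CLINT y|\<rho>. (\<i> * y) ^ j * iexp ((t + h) * y) - (\<Sum>i<n. (\<i> * y) ^ (j + i) * iexp (t * y) * h ^ i / fact i))"
    (is "_ = (CLINT y|\<rho>. ?F y)")
    unfolding D_def
    by (subst Bochner_Integration.integral_diff[OF ints Bochner_Integration.integrable_sum])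
       (use ints in \<open>auto simp del: of_real_add of_real_mult of_real_power\<close>)
  also have "cmod \<dots> \<le> (\<integral>y. \<bar>y\<bar> ^ (j + n) * \<bar>h\<bar> ^ n / fact n \<partial>\<rho>)"
  proof (rule order_trans[OF integral_norm_bound], rule integral_mono)
    show "integrable \<rho> (\<lambda>y. cmod (?F y))"
      by (intro integrable_norm Bochner_Integration.integrable_diff Bochner_Integration.integrable_sum)
         (use ints in \<open>auto simp del: of_real_add of_real_mult of_real_power\<close>)
    show "integrable \<rho> (\<lambda>y. \<bar>y\<bar> ^ (j + n) * \<bar>h\<bar> ^ n / fact n)"
      using int by simp
    fix y :: real
    \<comment> \<open>Pulling out a factor of modulus \<open>\<bar>y\<bar> ^ j\<close> leaves the
      Taylor remainder of order \<open>n\<close> of the exponential.\<close>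
    have "?F y = (\<i> * y) ^ j * iexp (t * y) * (iexp (h * y) - (\<Sum>i<n. (\<i> * (h * y)) ^ i / fact i))"
      by (simp add: algebra_simps sum_distrib_left sum_distrib_right exp_add power_add power_mult_distrib)
    also have "cmod \<dots> = \<bar>y\<bar> ^ j * cmod (iexp (h * y) - (\<Sum>i<n. (\<i> * (h * y)) ^ i / fact i))"
      by (simp add: norm_mult norm_power)
    also have "\<dots> \<le> \<bar>y\<bar> ^ j * (\<bar>h * y\<bar> ^ n / fact n)"
    proof (intro mult_left_mono)
      show "cmod (iexp (h * y) - (\<Sum>i<n. (\<i> * (h * y)) ^ i / fact i)) \<le> \<bar>h * y\<bar> ^ n / fact n"
      proof (cases n)
        case (Suc m)
        thus ?thesis using iexp_approx1[of "h * y" m] by (simp add: lessThan_Suc_atMost)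
      qed simp
    qed auto
    finally show "cmod (?F y) \<le> \<bar>y\<bar> ^ (j + n) * \<bar>h\<bar> ^ n / fact n"
      by (simp add: power_add power_mult_distrib abs_mult mult_ac)
  qed
  finally show "cmod (D j (t + h) - (\<Sum>i<n. D (j + i) t * h ^ i / fact i))
          \<le> (\<integral>y. \<bar>y\<bar> ^ (j + n) \<partial>\<rho>) * \<bar>h\<bar> ^ n / fact n"
    by simp
qed

text \<open>At 0 the k-th derivative of a characteristic function is the k-th moment up to a power
  of i, so equal moments make the difference flat there. The majorant \<open>M\<close> is kept apart
  from the moments so that its log-convexity and growth can be read off an explicit formula.\<close>

lemma real_distribution_eq_if_moments_eq:
  fixes \<rho>1 \<rho>2 :: "real measure"
  assumes \<rho>: "real_distribution \<rho>1" "real_distribution \<rho>2"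
    and int: "\<And>k. integrable \<rho>1 (\<lambda>y. \<bar>y\<bar> ^ k)" "\<And>k. integrable \<rho>2 (\<lambda>y. \<bar>y\<bar> ^ k)"
    and eq: "\<And>k. (\<integral>y. y ^ k \<partial>\<rho>1) = (\<integral>y. y ^ k \<partial>\<rho>2)"
    and le: "\<And>k. (\<integral>y. \<bar>y\<bar> ^ k \<partial>\<rho>1) + (\<integral>y. \<bar>y\<bar> ^ k \<partial>\<rho>2) \<le> M k"
    and pos: "\<And>k. 0 < M k"
    and ratio: "incseq (\<lambda>k. M (Suc k) / M k)"
    and div: "\<not> summable (\<lambda>k. M k / M (Suc k))"
  shows "\<rho>1 = \<rho>2"
proof (rule Levy_uniqueness[OF \<rho>], rule ext)
  fix t :: real
  define D where "D \<rho> k t = (CLINT y|\<rho>. (\<i> * y) ^ k * iexp (t * y))" for \<rho> k and t :: real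
  define E where "E k t = D \<rho>1 k t - D \<rho>2 k t" for k t
  note T1 = char_taylor[of \<rho>1 "D \<rho>1", OF \<rho>(1) int(1) D_def]
  note T2 = char_taylor[of \<rho>2 "D \<rho>2", OF \<rho>(2) int(2) D_def]
  have "E 0 t = 0"
  proof (rule denjoy_carleman_vanishing[OF pos ratio _ _ _ div])
    fix k and x :: real
    show "cmod (E k x) \<le> M k"
      unfolding E_def using norm_triangle_ineq4[of "D \<rho>1 k x" "D \<rho>2 k x"] T1(1)[of k x] T2(1)[of k x] le[of k]
      by linarith
  next
    fix j n and x h :: real
    have "E j (x + h) - (\<Sum>i<n. E (j + i) x * h ^ i / fact i) =
       (D \<rho>1 j (x + h) - (\<Sum>i<n. D \<rho>1 (j + i) x * h ^ i / fact i)) -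
       (D \<rho>2 j (x + h) - (\<Sum>i<n. D \<rho>2 (j + i) x * h ^ i / fact i))"
      by (simp add: E_def left_diff_distrib diff_divide_distrib sum_subtractf)
    also have "cmod \<dots> \<le> (\<integral>y. \<bar>y\<bar> ^ (j + n) \<partial>\<rho>1) * \<bar>h\<bar> ^ n / fact n + (\<integral>y. \<bar>y\<bar> ^ (j + n) \<partial>\<rho>2) * \<bar>h\<bar> ^ n / fact n"
      by (rule order_trans[OF norm_triangle_ineq4]) (use T1(2)[of j x h n] T2(2)[of j x h n] in \<open>auto intro: add_mono\<close>)
    also have "\<dots> = ((\<integral>y. \<bar>y\<bar> ^ (j + n) \<partial>\<rho>1) + (\<integral>y. \<bar>y\<bar> ^ (j + n) \<partial>\<rho>2)) * \<bar>h\<bar> ^ n / fact n"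
      by (simp add: algebra_simps add_divide_distrib)
    also have "\<dots> \<le> M (j + n) * \<bar>h\<bar> ^ n / fact n"
      by (intro divide_right_mono mult_right_mono le) auto
    finally show "cmod (E j (x + h) - (\<Sum>i<n. E (j + i) x * h ^ i / fact i)) \<le> M (j + n) * \<bar>h\<bar> ^ n / fact n" .
  next
    fix k
    have "D \<rho> k 0 = \<i> ^ k * of_real (\<integral>y. y ^ k \<partial>\<rho>)" for \<rho>
      unfolding D_def by (simp add: power_mult_distrib flip: of_real_power)
    thus "E k 0 = 0" by (simp add: E_def eq)
  qed
  thus "char \<rho>1 t = char \<rho>2 t"
    by (simp add: E_def D_def char_def)
qed

section \<open>Uniqueness in the Stieltjes moment problem\<close>

text \<open>The independent fair sign annihilates the odd moments, so all moments are determined by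
  those of the given measure; squaring recovers that measure, so nothing is lost.\<close>

definition symm_root :: "real measure \<Rightarrow> real measure" where
  "symm_root \<nu> = distr (\<nu> \<Otimes>\<^sub>M measure_pmf (bernoulli_pmf (1/2))) borel
     (\<lambda>(x, b). (if b then 1 else -1) * sqrt x)"

lemma half_line_AE_nonneg:
  assumes "half_line_measure \<nu>"
  shows "AE x in \<nu>. 0 \<le> x"
  using assms unfolding half_line_measure_def
  by (intro AE_I[of _ _ "{..<0}"]) auto

lemma symm_root_props:
  assumes "prob_space \<nu>" and half: "half_line_measure \<nu>" and fin: "finite_moments \<nu>"
  shows symm_root_real_distribution: "real_distribution (symm_root \<nu>)"
    and symm_root_square: "distr (symm_root \<nu>) borel (\<lambda>y. y\<^sup>2) = \<nu>"
    and integrable_sqrt_power: "integrable \<nu> (\<lambda>x. \<bar>sqrt x\<bar> ^ k)"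
    and symm_root_integrable: "integrable (symm_root \<nu>) (\<lambda>y. \<bar>y\<bar> ^ k)"
    and symm_root_abs_moment: "(\<integral>y. \<bar>y\<bar> ^ k \<partial>symm_root \<nu>) = (\<integral>x. \<bar>sqrt x\<bar> ^ k \<partial>\<nu>)"
    and symm_root_moment: "(\<integral>y. y ^ k \<partial>symm_root \<nu>) = (if even k then \<integral>x. x ^ (k div 2) \<partial>\<nu> else 0)"
proof -
  interpret prob_space \<nu> by fact
  have sets[measurable_cong, simp]: "sets \<nu> = sets borel" using half by (simp add: half_line_measure_def)
  define B where "B = measure_pmf (bernoulli_pmf (1/2))"
  interpret B: prob_space B unfolding B_def by (rule measure_pmf.prob_space_axioms)
  interpret P: pair_prob_space \<nu> B ..
  define \<sigma> :: "real \<times> bool \<Rightarrow> real" where "\<sigma> = (\<lambda>(x, b). (if b then 1 else -1) * sqrt x)"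
  have sets_B[measurable_cong, simp]: "sets B = sets (count_space UNIV)" by (simp add: B_def)
  have \<sigma>[measurable]: "\<sigma> \<in> borel_measurable (\<nu> \<Otimes>\<^sub>M B)"
    unfolding \<sigma>_def by measurable
  have symm: "symm_root \<nu> = distr (\<nu> \<Otimes>\<^sub>M B) borel \<sigma>"
    by (simp add: symm_root_def B_def \<sigma>_def)
  show "real_distribution (symm_root \<nu>)"
    unfolding symm by (rule P.real_distribution_distr) fact
  \<comment> \<open>\<open>sqrt\<close> is continued to negative arguments as an odd function, hence
    the absolute value; it goes away because the negative axis is a null set.\<close>
  have sq: "(sqrt x)\<^sup>2 = \<bar>x\<bar>" for x
    by (metis real_sqrt_power real_sqrt_abs)
  have "distr (symm_root \<nu>) borel (\<lambda>y. y\<^sup>2) = distr (\<nu> \<Otimes>\<^sub>M B) borel (\<lambda>p. \<bar>fst p\<bar>)"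
    unfolding symm by (subst distr_distr) (auto simp: o_def \<sigma>_def power_mult_distrib sq intro!: distr_cong)
  also have "\<dots> = distr (distr (\<nu> \<Otimes>\<^sub>M B) \<nu> fst) borel abs"
    by (subst distr_distr) (auto simp: o_def)
  also have "distr (\<nu> \<Otimes>\<^sub>M B) \<nu> fst = \<nu>"
    by (rule B.distr_pair_fst)
  also have "distr \<nu> borel abs = distr \<nu> \<nu> (\<lambda>x. x)"
    using half_line_AE_nonneg[OF half] by (intro distr_cong_AE) auto
  finally show "distr (symm_root \<nu>) borel (\<lambda>y. y\<^sup>2) = \<nu>"
    by (simp add: distr_id)
  have int: "integrable \<nu> (\<lambda>x. \<bar>sqrt x\<bar> ^ k)" for k
  proof (rule Bochner_Integration.integrable_bound)
    show "integrable \<nu> (\<lambda>x. 1 + \<bar>x ^ k\<bar>)"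
      using fin by (auto simp: finite_moments_def)
    show "AE x in \<nu>. norm (\<bar>sqrt x\<bar> ^ k) \<le> norm (1 + \<bar>x ^ k\<bar>)"
    proof (intro AE_I2)
      fix x :: real
      have "\<bar>sqrt x\<bar> ^ k \<le> 1 + \<bar>x\<bar> ^ k"
      proof (cases "\<bar>x\<bar> \<le> 1")
        case True
        hence "\<bar>sqrt x\<bar> ^ k \<le> 1" by (intro power_le_one) (auto simp flip: real_sqrt_abs')
        thus ?thesis by (smt (verit) zero_le_power abs_ge_zero)
      next
        case False
        have "sqrt \<bar>x\<bar> \<le> \<bar>x\<bar>" using False self_le_power[of "\<bar>x\<bar>" 2] by (intro real_le_lsqrt) auto
        hence "\<bar>sqrt x\<bar> ^ k \<le> \<bar>x\<bar> ^ k" by (intro power_mono) (auto simp: real_sqrt_abs')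
        thus ?thesis by simp
      qed
      thus "norm (\<bar>sqrt x\<bar> ^ k) \<le> norm (1 + \<bar>x ^ k\<bar>)" by (simp add: power_abs)
    qed
  qed simp
  show "integrable \<nu> (\<lambda>x. \<bar>sqrt x\<bar> ^ k)" by (rule int)
  have intP: "integrable (\<nu> \<Otimes>\<^sub>M B) (\<lambda>p. \<sigma> p ^ k)" for k
  proof (rule P.Fubini_integrable)
    show "integrable \<nu> (\<lambda>x. \<integral>b. norm (\<sigma> (x, b) ^ k) \<partial>B)"
      using int[of k] by (simp add: B_def \<sigma>_def power_abs abs_mult)
    show "AE x in \<nu>. integrable B (\<lambda>b. \<sigma> (x, b) ^ k)"
      by (simp add: B_def integrable_measure_pmf_finite)
  qed simp
  show "integrable (symm_root \<nu>) (\<lambda>y. \<bar>y\<bar> ^ k)"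
    using integrable_norm[OF intP[of k]] unfolding symm by (subst integrable_distr_eq) (auto simp: power_abs)
  have "(\<integral>y. \<bar>y\<bar> ^ k \<partial>symm_root \<nu>) = (\<integral>p. \<bar>\<sigma> p ^ k\<bar> \<partial>(\<nu> \<Otimes>\<^sub>M B))"
    unfolding symm by (subst integral_distr) (auto simp: power_abs)
  also have "\<dots> = (\<integral>x. (\<integral>b. \<bar>\<sigma> (x, b) ^ k\<bar> \<partial>B) \<partial>\<nu>)"
    using integrable_norm[OF intP[of k]] by (subst P.integral_fst'[symmetric]) auto
  also have "\<dots> = (\<integral>x. \<bar>sqrt x\<bar> ^ k \<partial>\<nu>)"
    by (simp add: B_def \<sigma>_def power_abs abs_mult)
  finally show "(\<integral>y. \<bar>y\<bar> ^ k \<partial>symm_root \<nu>) = (\<integral>x. \<bar>sqrt x\<bar> ^ k \<partial>\<nu>)" .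
  have "(\<integral>y. y ^ k \<partial>symm_root \<nu>) = (\<integral>p. \<sigma> p ^ k \<partial>(\<nu> \<Otimes>\<^sub>M B))"
    unfolding symm by (subst integral_distr) auto
  also have "\<dots> = (\<integral>x. (\<integral>b. \<sigma> (x, b) ^ k \<partial>B) \<partial>\<nu>)"
    using intP[of k] by (subst P.integral_fst'[symmetric]) auto
  also have "\<dots> = (\<integral>x. (if even k then x ^ (k div 2) else 0) \<partial>\<nu>)"
  proof (rule integral_cong_AE)
    show "AE x in \<nu>. (\<integral>b. \<sigma> (x, b) ^ k \<partial>B) = (if even k then x ^ (k div 2) else 0)"
      using half_line_AE_nonneg[OF half]
    proof eventually_elim
      case (elim x)
      have "sqrt x ^ k = x ^ (k div 2)" if "even k"
        using that elim by (metis dvd_mult_div_cancel power_mult real_sqrt_pow2)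
      thus ?case by (auto simp: B_def \<sigma>_def)
    qed
  qed (auto simp: B_def \<sigma>_def)
  finally show "(\<integral>y. y ^ k \<partial>symm_root \<nu>) = (if even k then \<integral>x. x ^ (k div 2) \<partial>\<nu> else 0)"
    by simp
qed

text \<open>The factor 2 accounts for the two solutions of the same moment problem. An odd power of
  \<open>sqrt x\<close> has half-integer order in \<open>x\<close> and is estimated by
  \<open>1 + x ^ m\<close> with \<open>m\<close> rounded up, which explains the summand 1 and the
  exponent \<open>Suc n\<close>.\<close>

lemma stieltjes_determinate:
  assumes \<nu>: "prob_space \<nu>" "half_line_measure \<nu>" "finite_moments \<nu>"
    and pos: "\<And>k. 0 < M k"
    and le: "\<And>n. 2 * (1 + (\<integral>x. x ^ n \<partial>\<nu>)) \<le> M (2 * n)" "\<And>n. 2 * (1 + (\<integral>x. x ^ Suc n \<partial>\<nu>)) \<le> M (2 * n + 1)"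
    and ratio: "incseq (\<lambda>k. M (Suc k) / M k)"
    and div: "\<not> summable (\<lambda>k. M k / M (Suc k))"
  shows "moment_determinate \<nu>"
  unfolding moment_determinate_def
proof (intro allI impI, elim conjE)
  fix \<mu> assume \<mu>: "half_line_measure \<mu>" "finite_moments \<mu>"
    and eq: "\<forall>n::nat. (\<integral>x. x ^ n \<partial>\<mu>) = (\<integral>x. x ^ n \<partial>\<nu>)"
  \<comment> \<open>The zeroth moments agree, so the competitor is a probability measure
    too.\<close>
  have "integrable \<mu> (\<lambda>x. 1::real)" using \<mu>(2) by (auto simp: finite_moments_def dest: spec[of _ 0])
  hence "finite_measure \<mu>" by (intro finite_measureI) (simp add: integrable_iff_bounded)
  moreover have "measure \<mu> (space \<mu>) = 1"
    using eq[rule_format, of 0] \<nu>(1) by (simp add: prob_space.prob_space)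
  ultimately have p\<mu>: "prob_space \<mu>"
    by (auto intro!: prob_spaceI simp: finite_measure.emeasure_eq_measure)
  have half_le: "(\<integral>x. \<bar>sqrt x\<bar> ^ k \<partial>\<rho>) \<le> 1 + (\<integral>x. x ^ ((k + 1) div 2) \<partial>\<rho>)"
    if \<rho>: "prob_space \<rho>" "half_line_measure \<rho>" "finite_moments \<rho>" for \<rho> k
  proof -
    interpret prob_space \<rho> by fact
    have "(\<integral>x. \<bar>sqrt x\<bar> ^ k \<partial>\<rho>) \<le> (\<integral>x. 1 + x ^ ((k + 1) div 2) \<partial>\<rho>)"
    proof (rule integral_mono_AE)
      show "integrable \<rho> (\<lambda>x. 1 + x ^ ((k + 1) div 2))" using \<rho>(3) by (auto simp: finite_moments_def)
      show "AE x in \<rho>. \<bar>sqrt x\<bar> ^ k \<le> 1 + x ^ ((k + 1) div 2)"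
        using half_line_AE_nonneg[OF \<rho>(2)]
      proof eventually_elim
        case (elim x)
        define m where "m = (k + 1) div 2"
        show ?case
        proof (cases "x \<le> 1")
          case True
          hence "\<bar>sqrt x\<bar> ^ k \<le> 1" using elim by (intro power_le_one) auto
          moreover have "0 \<le> x ^ m" using elim by simp
          ultimately show ?thesis by (simp add: m_def)
        next
          case False
          have "\<bar>sqrt x\<bar> ^ k \<le> \<bar>sqrt x\<bar> ^ (2 * m)" using False by (intro power_increasing) (auto simp: m_def)
          also have "\<dots> = x ^ m" using elim by (simp add: power_mult)
          finally show ?thesis by (simp add: m_def)
        qed
      qed
    qed (use integrable_sqrt_power[OF \<rho>] in auto)
    also have "\<dots> = 1 + (\<integral>x. x ^ ((k + 1) div 2) \<partial>\<rho>)"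
      using \<rho>(3) by (subst Bochner_Integration.integral_add) (auto simp: finite_moments_def prob_space)
    finally show ?thesis .
  qed
  have "symm_root \<mu> = symm_root \<nu>"
  proof (rule real_distribution_eq_if_moments_eq[where M = M])
    fix k
    show "(\<integral>y. \<bar>y\<bar> ^ k \<partial>symm_root \<mu>) + (\<integral>y. \<bar>y\<bar> ^ k \<partial>symm_root \<nu>) \<le> M k"
    proof (cases "even k")
      case True
      then obtain n where "k = 2 * n" by auto
      thus ?thesis using half_le[OF \<nu>, of k] half_le[OF p\<mu> \<mu>, of k] le(1)[of n] eq
        by (simp add: symm_root_abs_moment[OF \<nu>] symm_root_abs_moment[OF p\<mu> \<mu>])
    next
      case False
      then obtain n where "k = 2 * n + 1" by (auto elim: oddE)
      thus ?thesis using half_le[OF \<nu>, of k] half_le[OF p\<mu> \<mu>, of k] le(2)[of n] eq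
        by (simp del: power_Suc add: symm_root_abs_moment[OF \<nu>] symm_root_abs_moment[OF p\<mu> \<mu>])
    qed
    show "(\<integral>y. y ^ k \<partial>symm_root \<mu>) = (\<integral>y. y ^ k \<partial>symm_root \<nu>)"
      using eq by (simp add: symm_root_moment[OF \<nu>] symm_root_moment[OF p\<mu> \<mu>])
  qed (use div in \<open>auto intro: symm_root_real_distribution symm_root_integrable \<nu> \<mu> p\<mu> pos ratio\<close>)
  thus "\<mu> = \<nu>"
    using symm_root_square[OF \<nu>] symm_root_square[OF p\<mu> \<mu>] by metis
qed

lemma integrable_inverse_1_plus_square:
  "integrable lborel (\<lambda>x::real. inverse (1 + x\<^sup>2))"
proof -
  define k :: "real \<Rightarrow> real" where "k x = indicator {0<..} x * inverse (1 + x\<^sup>2)" for x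
  have k: "integrable lborel k"
    using integrable_I0i_1_div_plus_square
    unfolding k_def interval_lebesgue_integrable_def set_integrable_def by (simp add: zero_ereal_def divide_inverse)
  have "integrable lborel (\<lambda>x. k (0 + (-1) * x))"
    by (rule lborel_integrable_real_affine[OF k]) simp
  hence "integrable lborel (\<lambda>x. k x + k (0 + (-1) * x))"
    using k by (rule Bochner_Integration.integrable_add[rotated])
  moreover have "AE x in lborel. k x + k (0 + (-1) * x) = inverse (1 + x\<^sup>2)"
    using AE_lborel_singleton[of 0] by eventually_elim (auto simp: k_def indicator_def)
  ultimately show ?thesis
    by (subst integrable_cong_AE) (auto simp: k_def eq_commute)
qed

section \<open>Moment bounds from the Legendre transform\<close>

text \<open>\<open>g\<close> is a strictly increasing subgradient of \<open>G\<close> on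
  \<open>{A..}\<close>, and \<open>v\<close> inverts it on all reals from \<open>N\<close> on. The
  bound \<open>N \<ge> 2\<close> leaves a factor \<open>inverse (x\<^sup>2)\<close> to spare in the
  moment estimates and keeps the slope \<open>N - 1\<close> positive when \<open>G\<close> is
  compared with a sum of positive parts.\<close>

locale convex_legendre =
  fixes G g v :: "real \<Rightarrow> real" and A :: real and N :: nat
  assumes A_nonneg: "0 \<le> A"
    and N_ge: "2 \<le> N"
    and G_nonneg: "\<And>u. A \<le> u \<Longrightarrow> 0 \<le> G u"
    and G_cont: "continuous_on {A..} G"
    and tangent: "\<And>u w. A \<le> u \<Longrightarrow> A \<le> w \<Longrightarrow> G u + g u * (w - u) \<le> G w"
    and g_strict: "\<And>u w. A \<le> u \<Longrightarrow> u < w \<Longrightarrow> g u < g w"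
    and v_ge: "\<And>s. real N \<le> s \<Longrightarrow> A \<le> v s"
    and g_v: "\<And>s. real N \<le> s \<Longrightarrow> g (v s) = s"
begin

lemma v_strict: "real N \<le> s \<Longrightarrow> s < t \<Longrightarrow> v s < v t"
  using g_strict[of "v t" "v s"] v_ge[of t] g_v[of s] g_v[of t] by (cases "v t" "v s" rule: linorder_cases) auto

lemma v_mono: "real N \<le> s \<Longrightarrow> s \<le> t \<Longrightarrow> v s \<le> v t"
  using v_strict[of s t] by (cases "s = t") auto

lemma le_v: "A \<le> u \<Longrightarrow> real N \<le> s \<Longrightarrow> g u \<le> s \<Longrightarrow> u \<le> v s"
  using g_strict[of "v s" u] v_ge[of s] g_v[of s] by linarith

text \<open>For \<open>s \<ge> N\<close>, the tangent inequality at \<open>v s\<close> shows that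
  this is the maximum of \<open>s * u - G u\<close> over \<open>u \<ge> A\<close>, that is, the
  Legendre transform.\<close>

definition L :: "real \<Rightarrow> real" where "L s = s * v s - G (v s)"

lemma L_ge: "A \<le> u \<Longrightarrow> real N \<le> s \<Longrightarrow> s * u - G u \<le> L s"
  using tangent[of "v s" u] v_ge[of s] g_v[of s] by (simp add: L_def algebra_simps)

text \<open>\<open>v s\<close> is a subgradient of \<open>L\<close> at \<open>s\<close>, because the
  point \<open>v s\<close> competes in the maximum that defines \<open>L t\<close>. As
  \<open>t\<close> may lie on either side of \<open>s\<close>, this yields both convexity and the
  size of increments.\<close>

lemma L_increment: "real N \<le> s \<Longrightarrow> real N \<le> t \<Longrightarrow> L s + (t - s) * v s \<le> L t"
  using L_ge[of "v s" t] v_ge[of s] by (simp add: L_def algebra_simps)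

lemma L_mono: "real N \<le> s \<Longrightarrow> s \<le> t \<Longrightarrow> L s \<le> L t"
  using L_increment[of s t] v_ge[of s] A_nonneg mult_nonneg_nonneg[of "t - s" "v s"] by linarith

text \<open>The ratio \<open>M (Suc k) / M k\<close> is e times the exponential of an increment of
  \<open>L\<close> over a half-unit step, which is at most half of \<open>v\<close> at the right end
  point. Divergence of the series of \<open>exp (- v / 2)\<close> thus forces divergence of the
  series of inverse ratios.\<close>

lemma determinate_if_moments_le:
  assumes \<nu>: "prob_space \<nu>" "half_line_measure \<nu>" "finite_moments \<nu>"
    and C: "0 \<le> C" "\<And>n::nat. (\<integral>x. x ^ n \<partial>\<nu>) \<le> C * exp (real n) * exp (L (real n + real N))"
    and div: "\<not> summable (\<lambda>n. exp (- (1/2) * v (real n + real N + 2)))"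
  shows "moment_determinate \<nu>"
proof -
  \<comment> \<open>The 2 is the one in \<open>stieltjes_determinate\<close>;
    \<open>exp (G A)\<close> absorbs the summand 1 there, since
    \<open>L s \<ge> s * A - G A \<ge> - G A\<close>.\<close>
  define C' where "C' = 2 * (exp (G A) + C)"
  have C'0: "0 < C'" using C(1) by (simp add: C'_def add_pos_nonneg)
  \<comment> \<open>\<open>k\<close> counts powers of \<open>sqrt x\<close>, so \<open>L\<close> is evaluated at half-integers; convexity of \<open>L\<close> is log-convexity of \<open>M\<close>.\<close>
  define M where "M k = C' * exp (real k) * exp (L (real k / 2 + real N + 1))" for k
  define d where "d k = L ((real k + 1) / 2 + real N + 1) - L (real k / 2 + real N + 1)" for k
  have pos: "0 < M k" for k using C'0 by (simp add: M_def)
  have key: "2 * (1 + (\<integral>x. x ^ n \<partial>\<nu>)) \<le> M k" if "n \<le> k" "2 * n \<le> k + 1" for n k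
  proof -
    define s where "s = real k / 2 + real N + 1"
    have "1 \<le> exp (G A) * exp (real k) * exp (L s)"
    proof -
      have "s * A - G A \<le> L s" "0 \<le> s * A"
        using A_nonneg by (auto intro!: L_ge mult_nonneg_nonneg simp: s_def)
      thus ?thesis by (simp add: mult_exp_exp)
    qed
    moreover have "(\<integral>x. x ^ n \<partial>\<nu>) \<le> C * exp (real k) * exp (L s)"
    proof (rule order_trans[OF C(2)])
      have "L (real n + real N) \<le> L s" using that by (intro L_mono) (auto simp: s_def)
      thus "C * exp (real n) * exp (L (real n + real N)) \<le> C * exp (real k) * exp (L s)"
        using C(1) that by (intro mult_mono mult_left_mono) auto
    qed
    ultimately show ?thesis by (simp add: M_def C'_def s_def algebra_simps)
  qed
  have quot: "M (Suc k) / M k = exp 1 * exp (d k)" for k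
  proof -
    have "C' * exp (real k + 1) * exp b / (C' * exp (real k) * exp a) = exp 1 * exp (b - a)" for a b
      using C'0 by (simp add: exp_diff exp_add)
    moreover have "real (Suc k) = real k + 1" by simp
    ultimately show ?thesis unfolding M_def d_def by metis
  qed
  show ?thesis
  proof (rule stieltjes_determinate[OF \<nu> pos])
    show "2 * (1 + (\<integral>x. x ^ n \<partial>\<nu>)) \<le> M (2 * n)" for n
      by (rule key) auto
    show "2 * (1 + (\<integral>x. x ^ Suc n \<partial>\<nu>)) \<le> M (2 * n + 1)" for n
      by (rule key) auto
    show "incseq (\<lambda>k. M (Suc k) / M k)"
    proof (rule incseq_SucI)
      fix k
      define s where "s = (real k + 1) / 2 + real N + 1"
      \<comment> \<open>The two half-steps adjacent to \<open>s\<close> are compared with the same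
        subgradient \<open>v s\<close>.\<close>
      have "L s + 1/2 * v s \<le> L (s + 1/2)" "L s - 1/2 * v s \<le> L (s - 1/2)"
        using L_increment[of s "s + 1/2"] L_increment[of s "s - 1/2"] by (auto simp: s_def)
      moreover have "(real (Suc k) + 1) / 2 + real N + 1 = s + 1/2" "real k / 2 + real N + 1 = s - 1/2"
        "real (Suc k) / 2 + real N + 1 = s" "(real k + 1) / 2 + real N + 1 = s"
        by (auto simp: s_def field_simps)
      ultimately have "d k \<le> d (Suc k)" unfolding d_def by simp
      thus "M (Suc k) / M k \<le> M (Suc (Suc k)) / M (Suc k)" unfolding quot by simp
    qed
    show "\<not> summable (\<lambda>k. M k / M (Suc k))"
    proof
      assume "summable (\<lambda>k. M k / M (Suc k))"
      \<comment> \<open>Only odd indices are kept: for \<open>k = 2 * n + 1\<close> the right end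
        point of the half-step is the integer \<open>n + N + 2\<close>, as in the given
        series.\<close>
      moreover have "strict_mono (\<lambda>n::nat. 2 * n + 1)" by (auto simp: strict_mono_def)
      ultimately have "summable ((\<lambda>k. M k / M (Suc k)) \<circ> (\<lambda>n. 2 * n + 1))"
        using less_imp_le[OF pos] by (intro summable_reindex strict_mono_imp_inj_on) auto
      hence "summable (\<lambda>n. exp 1 * ((\<lambda>k. M k / M (Suc k)) \<circ> (\<lambda>n. 2 * n + 1)) n)"
        by (rule summable_mult)
      moreover have "norm (exp (- (1/2) * v (real n + real N + 2)))
          \<le> exp 1 * ((\<lambda>k. M k / M (Suc k)) \<circ> (\<lambda>n. 2 * n + 1)) n" for n
      proof -
        define s where "s = real n + real N + 2"
        have "L s - 1/2 * v s \<le> L (s - 1/2)"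
          using L_increment[of s "s - 1/2"] by (auto simp: s_def)
        moreover have "d (2 * n + 1) = L s - L (s - 1/2)"
          unfolding d_def by (intro arg_cong2[where f = minus] arg_cong[where f = L]) (auto simp: s_def field_simps)
        ultimately have "d (2 * n + 1) \<le> 1/2 * v s" by simp
        moreover have "M (2 * n + 1) / M (Suc (2 * n + 1)) = exp (-1) * exp (- d (2 * n + 1))"
        proof -
          have "M (2 * n + 1) / M (Suc (2 * n + 1)) = inverse (M (Suc (2 * n + 1)) / M (2 * n + 1))" by simp
          thus ?thesis by (simp only: quot exp_minus inverse_mult_distrib)
        qed
        ultimately show ?thesis by (simp add: s_def mult_exp_exp)
      qed
      ultimately have "summable (\<lambda>n. exp (- (1/2) * v (real n + real N + 2)))"
        by (rule summable_comparison_test'[where N = 0])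
      with div show False by simp
    qed
  qed
qed

text \<open>Evaluating \<open>L\<close> at \<open>n + N\<close> instead of \<open>n\<close> pays for
  \<open>N \<ge> 2\<close> additional powers of decay, which make the integral or the sum over large
  \<open>x\<close> converge.\<close>

lemma power_le_exp_L:
  assumes "A \<le> ln x" "0 < x"
  shows "x ^ n * exp (- G (ln x)) \<le> exp (L (real n + real N)) * exp (- 2 * ln x)"
proof -
  have "x ^ n = exp (real n * ln x)" using assms by (simp add: exp_of_nat_mult)
  moreover have "real n * ln x - G (ln x) \<le> L (real n + real N) - real N * ln x"
    using L_ge[OF assms(1), of "real n + real N"] by (simp add: algebra_simps)
  moreover have "2 * ln x \<le> real N * ln x"
    using N_ge order_trans[OF A_nonneg assms(1)] by (intro mult_right_mono) auto
  ultimately show ?thesis by (simp add: mult_exp_exp)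
qed

lemma power_le_exp_L':
  assumes "A \<le> u"
  shows "exp u ^ n \<le> exp (G u) * exp (L (real n + real N))"
proof -
  have "exp u ^ n = exp (real n * u)" by (simp add: exp_of_nat_mult)
  moreover have "0 \<le> real N * u" using assms A_nonneg by simp
  ultimately show ?thesis using L_ge[OF assms, of "real n + real N"] by (simp add: mult_exp_exp algebra_simps)
qed

text \<open>Below \<open>exp u\<close> the total mass 1 and the trivial power bound suffice; above
  it the spare decay is integrable. The factor \<open>exp (real n)\<close> gives the bound the same
  form as under the tail hypothesis, where rounding costs that much.\<close>

lemma density_moments_le:
  assumes \<nu>: "prob_space \<nu>" "half_line_measure \<nu>" "finite_moments \<nu>"
    and f: "is_density \<nu> f" "f \<in> O[at_top](\<lambda>x. exp (- G (ln x)))"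
  shows "\<exists>C\<ge>0. \<forall>n::nat. (\<integral>x. x ^ n \<partial>\<nu>) \<le> C * exp (real n) * exp (L (real n + real N))"
proof -
  interpret prob_space \<nu> by fact
  have f0: "\<And>x. 0 \<le> f x" and fm[measurable]: "f \<in> borel_measurable borel" and fd: "\<nu> = density lborel f"
    using f(1) by (auto simp: is_density_def)
  obtain c where c: "0 < c" "\<forall>\<^sub>F x in at_top. norm (f x) \<le> c * norm (exp (- G (ln x)))"
    using f(2) by (auto elim: landau_o.bigE)
  then obtain X where X: "\<And>x. X \<le> x \<Longrightarrow> f x \<le> c * exp (- G (ln x))"
    using f0 by (auto simp: eventually_at_top_linorder abs_of_nonneg)
  define u where "u = max A (ln (max X 1))"
  have u: "A \<le> u" "X \<le> exp u"
  proof -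
    have "X \<le> exp (ln (max X 1))" by simp
    also have "\<dots> \<le> exp u" unfolding u_def by (intro iffD2[OF exp_le_cancel_iff]) simp
    finally show "X \<le> exp u" .
  qed (simp add: u_def)
  \<comment> \<open>Comparable to the spare \<open>inverse (x\<^sup>2)\<close> for
    \<open>x \<ge> 1\<close>, but integrable over the whole line.\<close>
  define k :: "real \<Rightarrow> real" where "k x = inverse (1 + x\<^sup>2)" for x
  have k0: "0 \<le> k x" for x by (simp add: k_def)
  have kint: "integrable lborel k"
    using integrable_inverse_1_plus_square unfolding k_def .
  define K where "K = (\<integral>x. k x \<partial>lborel)"
  have K0: "0 \<le> K" unfolding K_def using k0 by simp
  have "(\<integral>x. x ^ n \<partial>\<nu>) \<le> (exp (G u) + 2 * c * K) * exp (real n) * exp (L (real n + real N))" for n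
  proof -
    have "integrable \<nu> (\<lambda>x. x ^ n)" using \<nu>(3) by (auto simp: finite_moments_def)
    hence int: "integrable lborel (\<lambda>x. f x * x ^ n)"
      unfolding fd using f0 by (subst (asm) integrable_density) auto
    have "integrable \<nu> (\<lambda>x. 1::real)" by simp
    hence int1: "integrable lborel f"
      unfolding fd using f0 by (subst (asm) integrable_density) auto
    have "(\<integral>x. (1::real) \<partial>\<nu>) = (\<integral>x. f x \<partial>lborel)"
      unfolding fd using f0 by (subst integral_density) auto
    hence one: "(\<integral>x. f x \<partial>lborel) = 1" by (simp add: prob_space)
    have AE0: "AE x in lborel. f x = 0 \<or> 0 \<le> x"
      using half_line_AE_nonneg[OF \<nu>(2)] f0 unfolding fd
      by (subst (asm) AE_density) (auto elim!: eventually_mono simp: less_le)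
    have "(\<integral>x. x ^ n \<partial>\<nu>) = (\<integral>x. f x * x ^ n \<partial>lborel)"
      unfolding fd using f0 by (subst integral_density) auto
    also have "\<dots> \<le> (\<integral>x. exp u ^ n * f x + 2 * c * exp (L (real n + real N)) * k x \<partial>lborel)"
    proof (rule integral_mono_AE)
      show "integrable lborel (\<lambda>x. exp u ^ n * f x + 2 * c * exp (L (real n + real N)) * k x)"
        using int1 kint by simp
      show "AE x in lborel. f x * x ^ n \<le> exp u ^ n * f x + 2 * c * exp (L (real n + real N)) * k x"
        using AE0
      proof eventually_elim
        case (elim x)
        show ?case
        proof (cases "f x = 0 \<or> x < exp u")
          case True
          have "f x * x ^ n \<le> exp u ^ n * f x"
          proof (cases "f x = 0")
            case False
            hence "x ^ n \<le> exp u ^ n" using True elim by (intro power_mono) auto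
            thus ?thesis using f0[of x] by (metis mult.commute mult_left_mono)
          qed simp
          moreover have "0 \<le> 2 * c * exp (L (real n + real N)) * k x" using c k0 by simp
          ultimately show ?thesis by linarith
        next
          case False
          hence x: "exp u \<le> x" by simp
          hence x0: "0 < x" using exp_gt_zero[of u] by linarith
          have x1: "1 \<le> x" using x u(1) A_nonneg one_le_exp_iff[of u] by linarith
          have "u \<le> ln x" using x x0 by (metis ln_exp ln_le_cancel_iff exp_gt_zero)
          have "f x * x ^ n \<le> c * exp (- G (ln x)) * x ^ n"
            using X[of x] x u x0 by (intro mult_right_mono) auto
          also have "\<dots> \<le> c * (exp (L (real n + real N)) * exp (- 2 * ln x))"
            using power_le_exp_L[of x n] u \<open>u \<le> ln x\<close> x0 c by (simp add: mult.assoc mult.commute mult_left_mono)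
          also have "exp (- 2 * ln x) = inverse (x\<^sup>2)"
            using x0 by (simp add: exp_minus exp_double)
          also have "inverse (x\<^sup>2) \<le> 2 * k x"
          proof -
            have "1 \<le> x\<^sup>2" using x1 by simp
            hence "1 + x\<^sup>2 \<le> 2 * x\<^sup>2" by simp
            hence "inverse (2 * x\<^sup>2) \<le> inverse (1 + x\<^sup>2)" by (rule le_imp_inverse_le) (simp add: add_pos_nonneg)
            thus ?thesis using x0 by (simp add: k_def)
          qed
          finally have "f x * x ^ n \<le> 2 * c * exp (L (real n + real N)) * k x"
            using c by (simp add: mult_left_mono algebra_simps)
          moreover have "0 \<le> exp u ^ n * f x" using f0 by simp
          ultimately show ?thesis by linarith
        qed
      qed
    qed (rule int)
    also have "\<dots> = exp u ^ n + 2 * c * exp (L (real n + real N)) * K"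
      using int1 kint by (simp add: one K_def)
    also have "\<dots> \<le> exp (G u) * exp (L (real n + real N)) + 2 * c * exp (L (real n + real N)) * K"
      using power_le_exp_L'[OF u(1)] by simp
    also have "\<dots> = (exp (G u) + 2 * c * K) * 1 * exp (L (real n + real N))"
      by (simp add: algebra_simps)
    also have "\<dots> \<le> (exp (G u) + 2 * c * K) * exp (real n) * exp (L (real n + real N))"
      using c K0 by (intro mult_right_mono mult_left_mono add_nonneg_nonneg) auto
    finally show ?thesis .
  qed
  thus ?thesis using c K0 by (intro exI[of _ "exp (G u) + 2 * c * K"]) auto
qed

text \<open>The half-line beyond \<open>exp J\<close> is cut at the points
  \<open>exp (J + i)\<close>. On one block \<open>x ^ n\<close> varies by at most a factor
  \<open>exp n\<close>, and the mass of the block is at most the tail at its left end; the spare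
  factor \<open>exp (- 2 * (J + i))\<close> makes the contributions summable.\<close>

lemma tail_moments_le:
  assumes \<nu>: "prob_space \<nu>" "half_line_measure \<nu>" "finite_moments \<nu>"
    and tail: "measure_tail \<nu> \<in> O[at_top](\<lambda>x. exp (- G (ln x)))"
  shows "\<exists>C\<ge>0. \<forall>n::nat. (\<integral>x. x ^ n \<partial>\<nu>) \<le> C * exp (real n) * exp (L (real n + real N))"
proof -
  interpret prob_space \<nu> by fact
  have sets[measurable_cong, simp]: "sets \<nu> = sets borel" using \<nu>(2) by (simp add: half_line_measure_def)
  obtain c where c: "0 < c" "\<forall>\<^sub>F x in at_top. norm (measure_tail \<nu> x) \<le> c * norm (exp (- G (ln x)))"
    using tail by (auto elim: landau_o.bigE)
  then obtain X where X: "\<And>x. X \<le> x \<Longrightarrow> measure \<nu> {x..} \<le> c * exp (- G (ln x))"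
    by (auto simp: eventually_at_top_linorder measure_tail_def)
  obtain J :: nat where J: "max A (ln (max X 1)) \<le> real J" using real_arch_simple by blast
  have JX: "X \<le> exp (real J)"
  proof -
    have "X \<le> exp (ln (max X 1))" by simp
    also have "\<dots> \<le> exp (real J)" using J by (intro iffD2[OF exp_le_cancel_iff]) simp
    finally show ?thesis .
  qed
  define S where "S = (\<Sum>i. exp (- real i))"
  have summ: "summable (\<lambda>i::nat. exp (- real i))"
    using summable_geometric[of "exp (-1::real)"] by (simp add: exp_of_nat_mult[symmetric])
  have S0: "0 \<le> S" unfolding S_def using summ by (intro suminf_nonneg) auto
  have le_suminf: "h i \<le> (\<Sum>j. h j)" for h :: "nat \<Rightarrow> ennreal" and i
    using sum_le_suminf[of h "{i}"] by simp
  have "(\<integral>x. x ^ n \<partial>\<nu>) \<le> (exp (G (real J)) + c * S) * exp (real n) * exp (L (real n + real N))" for n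
  proof -
    define E where "E = exp (L (real n + real N))"
    define t where "t i = exp (real (J + i + 1)) ^ n" for i
    have "ennreal (\<integral>x. x ^ n \<partial>\<nu>) = (\<integral>\<^sup>+x. ennreal (x ^ n) \<partial>\<nu>)"
      using \<nu>(3) half_line_AE_nonneg[OF \<nu>(2)]
      by (intro nn_integral_eq_integral[symmetric]) (auto simp: finite_moments_def)
    also have "\<dots> \<le> (\<integral>\<^sup>+x. ennreal (exp (real J) ^ n) + (\<Sum>i. ennreal (t i) * indicator {exp (real (J + i))..} x) \<partial>\<nu>)"
    proof (rule nn_integral_mono_AE)
      show "AE x in \<nu>. ennreal (x ^ n) \<le> ennreal (exp (real J) ^ n) + (\<Sum>i. ennreal (t i) * indicator {exp (real (J + i))..} x)"
        using half_line_AE_nonneg[OF \<nu>(2)]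
      proof eventually_elim
        case (elim x)
        show ?case
        proof (cases "x < exp (real J)")
          case True
          hence "ennreal (x ^ n) \<le> ennreal (exp (real J) ^ n)" using elim by (intro ennreal_leI power_mono) auto
          thus ?thesis by (simp add: add_increasing2)
        next
          case False
          hence x: "exp (real J) \<le> x" "0 < x" by (use False less_le_trans[OF exp_gt_zero, of "real J" x] in auto)
          hence lnx: "real J \<le> ln x" by (metis ln_exp ln_le_cancel_iff exp_gt_zero)
          \<comment> \<open>The index of the block containing \<open>x\<close>; the rays overlap,
            but this single term already majorises \<open>x ^ n\<close>.\<close>
          define i where "i = nat \<lfloor>ln x\<rfloor> - J"
          have "int J \<le> \<lfloor>ln x\<rfloor>" using lnx by (simp add: le_floor_iff)
          hence i: "real (J + i) \<le> ln x" "ln x \<le> real (J + i + 1)"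
            unfolding i_def by linarith+
          have xle: "exp (real (J + i)) \<le> x" "x \<le> exp (real (J + i + 1))"
            using i x(2) by (metis exp_le_cancel_iff exp_ln)+
          hence "x ^ n \<le> t i" unfolding t_def using elim by (intro power_mono) auto
          hence "ennreal (x ^ n) \<le> ennreal (t i) * indicator {exp (real (J + i))..} x"
            using xle by (auto intro: ennreal_leI)
          also have "\<dots> \<le> (\<Sum>i. ennreal (t i) * indicator {exp (real (J + i))..} x)"
            by (rule le_suminf)
          finally show ?thesis by (simp add: add_increasing)
        qed
      qed
    qed
    also have "\<dots> = ennreal (exp (real J) ^ n) + (\<Sum>i. ennreal (t i) * emeasure \<nu> {exp (real (J + i))..})"
      by (subst nn_integral_add)
         (auto simp: nn_integral_suminf nn_integral_cmult_indicator emeasure_space_1)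
    also have "(\<Sum>i. ennreal (t i) * emeasure \<nu> {exp (real (J + i))..}) \<le> (\<Sum>i. ennreal (c * exp (real n) * E * exp (- real i)))"
    proof (intro suminf_le summableI)
      fix i
      have "t i * measure \<nu> {exp (real (J + i))..} \<le> t i * (c * exp (- G (real (J + i))))"
        using X[OF order_trans[OF JX, of "exp (real (J + i))"]] by (intro mult_left_mono) (auto simp: t_def)
      also have "\<dots> = exp (real n) * exp (real (J + i)) ^ n * (c * exp (- G (real (J + i))))"
        by (simp add: t_def exp_add power_mult_distrib exp_of_nat_mult[symmetric])
      also have "exp (real n) * exp (real (J + i)) ^ n * (c * exp (- G (real (J + i)))) \<le>
          exp (real n) * c * (E * exp (- 2 * real (J + i)))"
        using power_le_exp_L[of "exp (real (J + i))" n] J c(1)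
        by (simp add: E_def mult_left_mono mult_ac)
      also have "\<dots> \<le> c * exp (real n) * E * exp (- real i)"
        using c(1) by (simp add: E_def)
      finally show "ennreal (t i) * emeasure \<nu> {exp (real (J + i))..} \<le> ennreal (c * exp (real n) * E * exp (- real i))"
        by (simp add: emeasure_eq_measure ennreal_mult[symmetric] t_def del: of_nat_add) (rule ennreal_leI)
    qed
    also have "\<dots> = ennreal (\<Sum>i. c * exp (real n) * E * exp (- real i))"
      using c(1) summ by (intro suminf_ennreal2 summable_mult) (auto simp: E_def)
    also have "(\<Sum>i. c * exp (real n) * E * exp (- real i)) = c * exp (real n) * E * S"
      unfolding S_def using summ by (rule suminf_mult)
    also have "ennreal (exp (real J) ^ n) + ennreal (c * exp (real n) * E * S) = ennreal (exp (real J) ^ n + c * exp (real n) * E * S)"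
      using c(1) S0 by (intro ennreal_plus[symmetric]) (auto simp: E_def)
    finally have "ennreal (\<integral>x. x ^ n \<partial>\<nu>) \<le> ennreal (exp (real J) ^ n + c * exp (real n) * E * S)"
      by (simp add: add_left_mono)
    hence "(\<integral>x. x ^ n \<partial>\<nu>) \<le> exp (real J) ^ n + c * exp (real n) * E * S"
      using c(1) S0 by (subst (asm) ennreal_le_iff) (auto simp: E_def)
    also have "exp (real J) ^ n \<le> exp (G (real J)) * 1 * E"
      using power_le_exp_L'[of "real J" n] J by (simp add: E_def)
    also have "\<dots> \<le> exp (G (real J)) * exp (real n) * E"
      by (intro mult_right_mono mult_left_mono) (auto simp: E_def)
    finally show ?thesis by (simp add: E_def algebra_simps)
  qed
  thus ?thesis using c S0 by (intro exI[of _ "exp (G (real J)) + c * S"]) auto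
qed

end

section \<open>Infinite products of sinc functions\<close>

definition csinc :: "complex \<Rightarrow> complex" where
  "csinc z = (if z = 0 then 1 else sin z / z)"

text \<open>Away from 0 this is the difference quotient of sine at 0, and at 0 it is the derivative
  of sine, so the singularity is removable.\<close>

lemma holomorphic_csinc: "csinc holomorphic_on UNIV"
proof -
  have "deriv sin (0::complex) = 1" by (intro DERIV_imp_deriv) (auto intro!: derivative_eq_intros)
  thus ?thesis
    by (intro holomorphic_transform[OF pole_lemma_open[OF holomorphic_on_sin, of UNIV 0]]) (auto simp: csinc_def)
qed

lemma holomorphic_csinc_scaled: "(\<lambda>z. csinc (of_real r * z)) holomorphic_on UNIV"
  using holomorphic_on_compose_gen[OF _ holomorphic_csinc, of "\<lambda>z. of_real r * z" UNIV]
  by (auto simp: o_def intro!: holomorphic_intros)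

lemma norm_sin_le_exp_Im: "norm (sin z :: complex) \<le> exp \<bar>Im z\<bar>"
proof -
  have "norm (sin z) = norm (exp (\<i> * z) - exp (- (\<i> * z))) / 2"
    by (simp add: sin_exp_eq norm_divide norm_mult)
  also have "\<dots> \<le> (norm (exp (\<i> * z)) + norm (exp (- (\<i> * z)))) / 2"
    by (intro divide_right_mono norm_triangle_ineq4) auto
  also have "\<dots> \<le> (exp \<bar>Im z\<bar> + exp \<bar>Im z\<bar>) / 2"
    by (intro divide_right_mono add_mono) (auto simp: norm_exp_eq_Re)
  finally show ?thesis by simp
qed

lemma sinc_sq_le_1: "(sinc x)\<^sup>2 \<le> 1"
proof -
  have "\<bar>sinc x\<bar> \<le> 1" using abs_sin_x_le_abs_x[of x] by auto
  thus ?thesis by (simp add: abs_square_le_1)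
qed

lemma sinc_sq_le_inverse: "0 < \<bar>x\<bar> \<Longrightarrow> (sinc x)\<^sup>2 \<le> inverse (x\<^sup>2)"
  using abs_square_le_1[of "sin x"]
  by (auto simp: power_mult_distrib power_inverse divide_inverse intro!: mult_left_le_one_le)

text \<open>This keeps the infinite product positive near 0. For
  \<open>\<bar>x\<bar> \<ge> 1\<close> the left side is not positive; otherwise the cubic Taylor
  remainder of sine gives the stronger \<open>1 - x\<^sup>2 / 6 \<le> sinc x\<close>.\<close>

lemma sinc_sq_ge: "1 - x\<^sup>2 \<le> (sinc x)\<^sup>2"
proof (cases "\<bar>x\<bar> < 1 \<and> x \<noteq> 0")
  case True
  have "\<bar>sin x - x\<bar> \<le> inverse (fact 3) * \<bar>x\<bar> ^ 3"
    using Maclaurin_sin_bound[of x 3] by (simp add: sin_coeff_def numeral_3_eq_3)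
  hence "\<bar>sin x / x - 1\<bar> \<le> x\<^sup>2 / 6"
    using True by (simp add: fact_numeral divide_simps abs_if power2_eq_square power3_eq_cube split: if_splits)
  hence "1 - x\<^sup>2 / 6 \<le> sin x / x" by linarith
  hence *: "1 - x\<^sup>2 / 6 \<le> sinc x" using True by simp
  have "x\<^sup>2 \<le> 1" using True by (simp add: abs_square_le_1)
  hence "(1 - x\<^sup>2 / 6)\<^sup>2 \<le> (sinc x)\<^sup>2" by (intro power_mono *) auto
  moreover have "1 - x\<^sup>2 \<le> (1 - x\<^sup>2 / 6)\<^sup>2"
  proof -
    have "1 - 6 * t \<le> (1 - t)\<^sup>2" if "0 \<le> t" for t :: real
      using that mult_nonneg_nonneg[OF that that] by (simp add: power2_eq_square algebra_simps)
    from this[of "x\<^sup>2 / 6"] show ?thesis by simp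
  qed
  ultimately show ?thesis by linarith
next
  case False
  thus ?thesis
  proof (cases "x = 0")
    case False
    hence "1 \<le> x\<^sup>2" using \<open>\<not> (\<bar>x\<bar> < 1 \<and> x \<noteq> 0)\<close> abs_le_square_iff[of 1 x] by simp
    thus ?thesis by (smt (verit) zero_le_power2)
  qed simp
qed

text \<open>The squares put every factor between 0 and 1, so that partial products decrease to a
  limit, and let each factor decay with unit slope in the variable
  \<open>ln (y\<^sup>2)\<close>.\<close>

definition sinc_prod :: "(nat \<Rightarrow> real) \<Rightarrow> nat \<Rightarrow> real \<Rightarrow> real" where
  "sinc_prod b n y = (\<Prod>i<n. (sinc (b i * y))\<^sup>2)"

lemma sinc_prod_nonneg: "0 \<le> sinc_prod b n y"
  unfolding sinc_prod_def by (intro prod_nonneg) (rule zero_le_power2)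

lemma sinc_prod_le_1: "sinc_prod b n y \<le> 1"
  unfolding sinc_prod_def by (intro prod_le_1 conjI sinc_sq_le_1 zero_le_power2)

lemma sinc_prod_Suc_le: "sinc_prod b (Suc n) y \<le> sinc_prod b n y"
  using mult_left_mono[OF sinc_sq_le_1[of "b n * y"] sinc_prod_nonneg[of b n y]] by (simp add: sinc_prod_def)

lemma sinc_prod_decseq: "decseq (\<lambda>n. sinc_prod b n y)"
  by (rule decseq_SucI) (rule sinc_prod_Suc_le)

lemma sinc_prod_even: "sinc_prod b n (- y) = sinc_prod b n y"
proof -
  have "sinc (b i * - y) = sinc (b i * y)" for i by simp
  thus ?thesis unfolding sinc_prod_def by presburger
qed

lemma continuous_sinc_prod: "continuous_on S (sinc_prod b n)"
  unfolding sinc_prod_def[abs_def] by (intro continuous_intros)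

lemma measurable_sinc_prod[measurable]: "sinc_prod b n \<in> borel_measurable borel"
  by (rule borel_measurable_continuous_onI) (rule continuous_sinc_prod)

lemma sinc_prod_le_prod:
  assumes "\<And>i. i \<in> I \<Longrightarrow> 0 < b i" "0 < y" "I \<subseteq> {..<n}"
  shows "sinc_prod b n y \<le> (\<Prod>i\<in>I. inverse ((b i * y)\<^sup>2))"
proof -
  have "sinc_prod b n y = (\<Prod>i\<in>I. (sinc (b i * y))\<^sup>2) * (\<Prod>i\<in>{..<n} - I. (sinc (b i * y))\<^sup>2)"
    unfolding sinc_prod_def by (subst prod.subset_diff[OF assms(3) finite_lessThan]) (rule mult.commute)
  also have "\<dots> \<le> (\<Prod>i\<in>I. inverse ((b i * y)\<^sup>2)) * 1"
  proof (intro mult_mono prod_mono prod_le_1 prod_nonneg ballI conjI)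
    fix i assume "i \<in> I"
    thus "(sinc (b i * y))\<^sup>2 \<le> inverse ((b i * y)\<^sup>2)"
      using assms(1)[of i] assms(2) by (intro sinc_sq_le_inverse) auto
  qed (rule sinc_sq_le_1 zero_le_power2 inverse_nonnegative_iff_nonnegative[THEN iffD2])+
  finally show ?thesis by simp
qed

lemma sinc_prod_decay:
  assumes b: "\<And>i. i < n \<Longrightarrow> 0 < b i" and m: "m + 2 \<le> 2 * n"
  shows "\<exists>K. \<forall>y. \<bar>y\<bar> ^ m * sinc_prod b n y \<le> K * inverse (1 + y\<^sup>2)"
proof -
  define B where "B = (\<Prod>i<n. inverse ((b i)\<^sup>2))"
  have B0: "0 \<le> B" unfolding B_def by (intro prod_nonneg) auto
  have "\<bar>y\<bar> ^ m * sinc_prod b n y \<le> (2 + 2 * B) * inverse (1 + y\<^sup>2)" for y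
  proof (cases "\<bar>y\<bar> \<le> 1")
    case True
    have "\<bar>y\<bar> ^ m * sinc_prod b n y \<le> 1 * 1"
      using True sinc_prod_nonneg sinc_prod_le_1 by (intro mult_mono power_le_one) auto
    also have "1 * 1 \<le> 2 * inverse (1 + y\<^sup>2)"
      using True by (simp add: field_simps add_pos_nonneg abs_square_le_1)
    also have "\<dots> \<le> (2 + 2 * B) * inverse (1 + y\<^sup>2)"
      using B0 by (intro mult_right_mono) auto
    finally show ?thesis .
  next
    case False
    have "sinc_prod b n y = sinc_prod b n \<bar>y\<bar>" by (simp add: abs_if sinc_prod_even)
    also have "\<dots> \<le> (\<Prod>i<n. inverse ((b i * \<bar>y\<bar>)\<^sup>2))"
      using b False by (intro sinc_prod_le_prod) auto
    also have "\<dots> = B * inverse (\<bar>y\<bar> ^ (2 * n))"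
      by (simp add: B_def power_mult_distrib prod.distrib power_mult power_inverse)
    finally have "\<bar>y\<bar> ^ m * sinc_prod b n y \<le> \<bar>y\<bar> ^ m * (B * inverse (\<bar>y\<bar> ^ (2 * n)))"
      by (intro mult_left_mono) auto
    also have "\<dots> \<le> \<bar>y\<bar> ^ m * (B * inverse (\<bar>y\<bar> ^ (m + 2)))"
      using False B0 m by (intro mult_left_mono le_imp_inverse_le power_increasing) auto
    also have "\<dots> = B * inverse (\<bar>y\<bar>\<^sup>2)" using False by (cases "y = 0") (auto simp: power_add power2_eq_square field_simps)
    also have "\<dots> = B * inverse (y\<^sup>2)" by simp
    also have "inverse (y\<^sup>2) \<le> 2 * inverse (1 + y\<^sup>2)"
    proof -
      have "1 \<le> y\<^sup>2" using False abs_le_square_iff[of 1 y] by simp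
      hence "1 + y\<^sup>2 \<le> 2 * y\<^sup>2" "0 < y\<^sup>2" "0 < 1 + y\<^sup>2" by auto
      thus ?thesis by (simp add: divide_simps)
    qed
    hence "B * inverse (y\<^sup>2) \<le> B * (2 * inverse (1 + y\<^sup>2))" using B0 by (rule mult_left_mono)
    also have "\<dots> \<le> (2 + 2 * B) * inverse (1 + y\<^sup>2)"
      by (simp add: algebra_simps add_pos_nonneg)
    finally show ?thesis .
  qed
  thus ?thesis by blast
qed

text \<open>Formulated for any \<open>P\<close> below a finite product, so that it covers the finite
  products and their limit alike.\<close>

lemma integrable_power_cos_mult:
  assumes "\<And>i. i < n \<Longrightarrow> 0 < b i" "m + 2 \<le> 2 * n" "P \<in> borel_measurable borel"
    and P: "\<And>y. 0 \<le> P y" "\<And>y. P y \<le> sinc_prod b n y"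
  shows "integrable lborel (\<lambda>y. y ^ m * cos (c * y) * P y)"
proof -
  obtain K where K: "\<And>y. \<bar>y\<bar> ^ m * sinc_prod b n y \<le> K * inverse (1 + y\<^sup>2)"
    using sinc_prod_decay[of n b m] assms(1,2) by blast
  show ?thesis
  proof (rule Bochner_Integration.integrable_bound)
    show "integrable lborel (\<lambda>y. K * inverse (1 + y\<^sup>2))"
      using integrable_inverse_1_plus_square by simp
    show "AE y in lborel. norm (y ^ m * cos (c * y) * P y) \<le> norm (K * inverse (1 + y\<^sup>2))"
    proof (rule AE_I2)
      fix y
      have "norm (y ^ m * cos (c * y) * P y) \<le> \<bar>y\<bar> ^ m * 1 * sinc_prod b n y"
        unfolding norm_mult using P by (intro mult_mono) (auto simp: norm_power power_abs abs_of_nonneg)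
      also have "\<dots> \<le> K * inverse (1 + y\<^sup>2)" using K by simp
      finally show "norm (y ^ m * cos (c * y) * P y) \<le> norm (K * inverse (1 + y\<^sup>2))" by simp
    qed
  qed (use assms(3) in measurable)
qed

text \<open>Finite products come first because they extend to entire functions with an explicit
  growth bound. The hypothesis on \<open>m\<close> leaves a decay of order
  \<open>inverse (R\<^sup>2)\<close> on a semicircle of length \<open>pi * R\<close>.\<close>

lemma integral_cos_sinc_prod_eq_0:
  assumes b: "\<And>i. i < n \<Longrightarrow> 0 < b i" and c: "2 * (\<Sum>i<n. b i) \<le> c" and m: "m + 2 \<le> 2 * n"
  shows "(\<integral>y. y ^ m * cos (c * y) * sinc_prod b n y \<partial>lborel) = 0"
proof -
  define F where "F z = z ^ m * exp (\<i> * of_real c * z) * (\<Prod>i<n. (csinc (of_real (b i) * z))\<^sup>2)" for z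
  define B where "B = (\<Prod>i<n. inverse ((b i)\<^sup>2))"
  have B0: "0 \<le> B" unfolding B_def by (intro prod_nonneg) auto
  have hol: "F holomorphic_on UNIV"
    unfolding F_def by (intro holomorphic_intros holomorphic_csinc_scaled)
  \<comment> \<open>The decay of \<open>exp (\<i> c z)\<close> in the upper half-plane cancels the growth of the sines.\<close>
  have arc: "norm (F z) \<le> B / R\<^sup>2" if z: "norm z = R" "1 \<le> R" "0 \<le> Im z" for z R
  proof -
    have "norm (csinc (of_real (b i) * z)) ^ 2 \<le> exp (2 * b i * Im z) * (inverse ((b i)\<^sup>2) * inverse (R\<^sup>2))"
      if i: "i < n" for i
    proof -
      have "norm (csinc (of_real (b i) * z)) = norm (sin (of_real (b i) * z)) / (b i * R)"
        using z b[OF i] by (auto simp: csinc_def norm_divide norm_mult)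
      also have "\<dots> \<le> exp \<bar>b i * Im z\<bar> / (b i * R)"
        using norm_sin_le_exp_Im[of "of_real (b i) * z"] z b[OF i] by (intro divide_right_mono) auto
      finally have "norm (csinc (of_real (b i) * z)) \<le> exp (b i * Im z) / (b i * R)"
        using z b[OF i] by simp
      hence "norm (csinc (of_real (b i) * z)) ^ 2 \<le> (exp (b i * Im z) / (b i * R)) ^ 2"
        by (intro power_mono) auto
      also have "\<dots> = exp (2 * b i * Im z) * (inverse ((b i)\<^sup>2) * inverse (R\<^sup>2))"
        by (simp add: power_divide power_mult_distrib exp_double[symmetric] divide_inverse power_inverse mult.assoc)
      finally show ?thesis .
    qed
    hence "norm (\<Prod>i<n. (csinc (of_real (b i) * z))\<^sup>2) \<le> (\<Prod>i<n. exp (2 * b i * Im z) * (inverse ((b i)\<^sup>2) * inverse (R\<^sup>2)))"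
      unfolding prod_norm[symmetric] norm_power by (intro prod_mono) auto
    also have "\<dots> = exp (\<Sum>i<n. 2 * b i * Im z) * (B * inverse (R ^ (2 * n)))"
      by (simp add: prod.distrib exp_sum B_def power_mult power_inverse)
    also have "(\<Sum>i<n. 2 * b i * Im z) = (2 * (\<Sum>i<n. b i)) * Im z"
      by (simp add: sum_distrib_left sum_distrib_right)
    also have "exp ((2 * (\<Sum>i<n. b i)) * Im z) * (B * inverse (R ^ (2 * n)))
        \<le> exp (c * Im z) * (B * inverse (R ^ (m + 2)))"
      using c z m B0 by (intro mult_mono iffD2[OF exp_le_cancel_iff] mult_right_mono mult_left_mono
          le_imp_inverse_le power_increasing) auto
    finally have "norm (F z) \<le> R ^ m * exp (- (c * Im z)) * (exp (c * Im z) * (B * inverse (R ^ (m + 2))))"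
      unfolding F_def norm_mult using z by (intro mult_mono) (auto simp: norm_power norm_exp_eq_Re)
    also have "\<dots> = B / R\<^sup>2"
      using z by (simp add: exp_minus power_add power2_eq_square field_simps)
    finally show ?thesis .
  qed
  define f where "f y = y ^ m * cos (c * y) * sinc_prod b n y" for y
  have Re_F: "Re (F (of_real y)) = f y" for y
  proof -
    have "csinc (of_real (b i) * of_real y) = of_real (sinc (b i * y))" for i
      by (auto simp: csinc_def sin_of_real simp flip: of_real_mult)
    hence "F (of_real y) = of_real (y ^ m) * cis (c * y) * of_real (sinc_prod b n y)"
      unfolding F_def sinc_prod_def by (simp add: cis_conv_exp mult_ac)
    thus ?thesis by (simp add: f_def)
  qed
  have int: "integrable lborel f"
    unfolding f_def using b m sinc_prod_nonneg by (intro integrable_power_cos_mult[where n = n and b = b]) auto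
  have small: "\<bar>\<integral>y. indicator {-R..R} y * f y \<partial>lborel\<bar> \<le> pi * B / R" if R: "1 \<le> R" for R
  proof -
    define g1 where "g1 = linepath (- of_real R) (of_real R :: complex)"
    define g2 where "g2 = part_circlepath 0 R 0 pi"
    have g2: "norm z = R" "0 \<le> Im z" if "z \<in> path_image g2" for z
      using that R unfolding g2_def path_image_part_circlepath'
      by (auto simp: norm_mult closed_segment_eq_real_ivl sin_ge_zero)
    have "(F has_contour_integral 0) (g1 +++ g2)"
      using R by (intro Cauchy_theorem_convex_simple[OF hol])
        (auto simp: g1_def g2_def intro!: valid_path_join)
    moreover have i1: "F contour_integrable_on g1" and i2: "F contour_integrable_on g2"
      by (rule contour_integrable_holomorphic_simple[OF hol]; simp add: g1_def g2_def)+
    ultimately have "contour_integral g1 F + contour_integral g2 F = 0"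
      using contour_integral_join[OF i1 i2] contour_integral_unique by (auto simp: g1_def g2_def)
    hence "norm (contour_integral g1 F) = norm (contour_integral g2 F)"
      by (metis add_eq_0_iff norm_minus_cancel)
    also have "\<dots> \<le> B / R\<^sup>2 * R * \<bar>pi - 0\<bar>"
      unfolding g2_def using R B0 i2 g2 arc
      by (intro contour_integral_bound_part_circlepath) (auto simp: g2_def)
    also have "\<dots> = pi * B / R" using R by (simp add: power2_eq_square)
    finally have n1: "norm (contour_integral g1 F) \<le> pi * B / R" .
    have "((\<lambda>y. F (of_real y)) has_integral contour_integral g1 F) {-R..R}"
      using has_contour_integral_integral[OF i1] R unfolding g1_def
      by (subst (asm) has_contour_integral_linepath_Reals_iff) auto
    hence "((\<lambda>y. Re (F (of_real y))) has_integral Re (contour_integral g1 F)) {-R..R}"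
      by (rule has_integral_Re)
    hence "integral {-R..R} f = Re (contour_integral g1 F)"
      unfolding Re_F by (rule integral_unique)
    moreover have "set_integrable lborel {-R..R} f"
      using int unfolding set_integrable_def by (intro integrable_mult_indicator) auto
    hence "(\<integral>y. indicator {-R..R} y * f y \<partial>lborel) = integral {-R..R} f"
      using set_borel_integral_eq_integral(2) by (fastforce simp: set_lebesgue_integral_def)
    ultimately show ?thesis
      using n1 abs_Re_le_cmod[of "contour_integral g1 F"] by linarith
  qed
  have "(\<lambda>k. \<integral>y. indicator {- real k..real k} y * f y \<partial>lborel) \<longlonglongrightarrow> (\<integral>y. f y \<partial>lborel)"
  proof (rule integral_dominated_convergence[where w = "\<lambda>y. norm (f y)"])
    show "AE y in lborel. (\<lambda>k. indicator {- real k..real k} y * f y) \<longlonglongrightarrow> f y"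
    proof (rule AE_I2)
      fix y
      have "\<forall>\<^sub>F k in sequentially. indicator {- real k..real k} y * f y = f y"
        using eventually_ge_at_top[of "nat \<lceil>\<bar>y\<bar>\<rceil>"]
      proof eventually_elim
        case (elim k)
        hence "\<bar>y\<bar> \<le> real k" by linarith
        thus ?case by (auto simp: indicator_def)
      qed
      thus "(\<lambda>k. indicator {- real k..real k} y * f y) \<longlonglongrightarrow> f y"
        by (rule tendsto_eventually)
    qed
  qed (use int in \<open>auto simp: indicator_def\<close>)
  moreover have "(\<lambda>k. \<integral>y. indicator {- real k..real k} y * f y \<partial>lborel) \<longlonglongrightarrow> 0"
  proof (rule Lim_null_comparison)
    show "\<forall>\<^sub>F k in sequentially. norm (\<integral>y. indicator {- real k..real k} y * f y \<partial>lborel) \<le> pi * B / real k"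
      using eventually_ge_at_top[of 1] by eventually_elim (use small in auto)
    show "(\<lambda>k. pi * B / real k) \<longlonglongrightarrow> 0" by real_asymp
  qed
  ultimately show ?thesis using LIMSEQ_unique unfolding f_def by blast
qed

section \<open>The infinite product of squared sinc functions\<close>

definition sinc_inf_prod :: "(nat \<Rightarrow> real) \<Rightarrow> real \<Rightarrow> real" where
  "sinc_inf_prod b y = lim (\<lambda>n. sinc_prod b n y)"

lemma sinc_prod_LIMSEQ: "(\<lambda>n. sinc_prod b n y) \<longlonglongrightarrow> sinc_inf_prod b y"
proof -
  have "convergent (\<lambda>n. sinc_prod b n y)"
    using sinc_prod_nonneg sinc_prod_decseq decseq_convergent convergent_def by metis
  thus ?thesis by (simp add: sinc_inf_prod_def convergent_LIMSEQ_iff)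
qed

lemma sinc_inf_prod_le: "sinc_inf_prod b y \<le> sinc_prod b n y"
  by (rule decseq_ge[OF sinc_prod_decseq sinc_prod_LIMSEQ])

lemma sinc_inf_prod_nonneg: "0 \<le> sinc_inf_prod b y"
  by (rule LIMSEQ_le_const[OF sinc_prod_LIMSEQ]) (auto intro: sinc_prod_nonneg)

lemma sinc_inf_prod_even: "sinc_inf_prod b (- y) = sinc_inf_prod b y"
  by (simp add: sinc_inf_prod_def sinc_prod_even)

lemma measurable_sinc_inf_prod[measurable]: "sinc_inf_prod b \<in> borel_measurable borel"
  by (rule borel_measurable_LIMSEQ_real[OF sinc_prod_LIMSEQ measurable_sinc_prod])

text \<open>Each new factor lowers the product by at most \<open>(b n * y)\<^sup>2\<close>, because
  the product so far is at most 1; and the squares of the \<open>b i\<close> sum to at most the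
  square of their sum.\<close>

lemma sinc_inf_prod_ge:
  assumes "\<And>i. 0 < b i" "summable b"
  shows "1 - (suminf b)\<^sup>2 * y\<^sup>2 \<le> sinc_inf_prod b y"
proof -
  have ge: "1 - (\<Sum>i<n. (b i * y)\<^sup>2) \<le> sinc_prod b n y" for n
  proof (induction n)
    case (Suc n)
    have "sinc_prod b n y * (1 - (b n * y)\<^sup>2) \<le> sinc_prod b n y * (sinc (b n * y))\<^sup>2"
      by (intro mult_left_mono sinc_sq_ge sinc_prod_nonneg)
    moreover have "sinc_prod b n y * (b n * y)\<^sup>2 \<le> 1 * (b n * y)\<^sup>2"
      by (intro mult_right_mono sinc_prod_le_1) auto
    moreover have "sinc_prod b (Suc n) y = sinc_prod b n y * (sinc (b n * y))\<^sup>2"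
      by (simp add: sinc_prod_def)
    ultimately show ?case using Suc by (simp add: algebra_simps)
  qed (simp add: sinc_prod_def)
  have "(\<Sum>i<n. (b i * y)\<^sup>2) \<le> (suminf b)\<^sup>2 * y\<^sup>2" for n
  proof -
    have "(\<Sum>i<n. (b i * y)\<^sup>2) \<le> (\<Sum>i<n. (b i * suminf b) * y\<^sup>2)"
    proof (intro sum_mono)
      fix i
      have "b i \<le> suminf b"
        using sum_le_suminf[of b "{i}"] assms less_imp_le by auto
      hence "b i * b i \<le> b i * suminf b" using assms(1)[of i] by (intro mult_left_mono) auto
      hence "b i * b i * y\<^sup>2 \<le> b i * suminf b * y\<^sup>2" by (intro mult_right_mono) auto
      thus "(b i * y)\<^sup>2 \<le> (b i * suminf b) * y\<^sup>2" by (simp add: power2_eq_square mult_ac)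
    qed
    also have "\<dots> = (\<Sum>i<n. b i) * suminf b * y\<^sup>2" by (simp add: sum_distrib_right)
    also have "\<dots> \<le> suminf b * suminf b * y\<^sup>2"
      using assms less_imp_le by (intro mult_right_mono sum_le_suminf suminf_nonneg) auto
    finally show ?thesis by (simp add: power2_eq_square)
  qed
  hence "1 - (suminf b)\<^sup>2 * y\<^sup>2 \<le> sinc_prod b n y" for n using ge[of n] by (smt (verit))
  thus ?thesis by (intro LIMSEQ_le_const[OF sinc_prod_LIMSEQ]) auto
qed

lemma integrable_cos_sinc_inf_prod:
  assumes "\<And>i. 0 < b i"
  shows "integrable lborel (\<lambda>y. y ^ m * cos (c * y) * sinc_inf_prod b y)"
  using assms by (intro integrable_power_cos_mult[where n = "m + 2" and b = b] sinc_inf_prod_nonneg sinc_inf_prod_le) auto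

lemma integral_cos_sinc_inf_prod_eq_0:
  assumes b: "\<And>i. 0 < b i" "summable b" and c: "2 * suminf b \<le> c"
  shows "(\<integral>y. y ^ m * cos (c * y) * sinc_inf_prod b y \<partial>lborel) = 0"
proof -
  \<comment> \<open>The offset \<open>m + 2\<close> keeps enough factors in every term for one
    common integrable majorant.\<close>
  define s where "s k y = y ^ m * cos (c * y) * sinc_prod b (k + (m + 2)) y" for k y
  obtain K where K: "\<And>y. \<bar>y\<bar> ^ m * sinc_prod b (m + 2) y \<le> K * inverse (1 + y\<^sup>2)"
    using sinc_prod_decay[of "m + 2" b m] b(1) by auto
  have "(\<lambda>k. \<integral>y. s k y \<partial>lborel) \<longlonglongrightarrow> (\<integral>y. y ^ m * cos (c * y) * sinc_inf_prod b y \<partial>lborel)"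
  proof (rule integral_dominated_convergence[where w = "\<lambda>y. K * inverse (1 + y\<^sup>2)"])
    show "integrable lborel (\<lambda>y. K * inverse (1 + y\<^sup>2))"
      using integrable_inverse_1_plus_square by simp
    show "AE y in lborel. (\<lambda>k. s k y) \<longlonglongrightarrow> y ^ m * cos (c * y) * sinc_inf_prod b y"
      unfolding s_def by (intro AE_I2 tendsto_intros LIMSEQ_ignore_initial_segment[OF sinc_prod_LIMSEQ])
    show "AE y in lborel. norm (s k y) \<le> K * inverse (1 + y\<^sup>2)" for k
    proof (rule AE_I2)
      fix y
      have "norm (s k y) \<le> \<bar>y\<bar> ^ m * 1 * sinc_prod b (m + 2) y"
        unfolding norm_mult s_def
        using sinc_prod_nonneg[of b "k + (m + 2)" y] decseqD[OF sinc_prod_decseq, of "m + 2" "k + (m + 2)" b y]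
        by (intro mult_mono) (auto simp: norm_power power_abs abs_of_nonneg)
      also have "\<dots> \<le> K * inverse (1 + y\<^sup>2)" using K by simp
      finally show "norm (s k y) \<le> K * inverse (1 + y\<^sup>2)" .
    qed
  qed (auto simp: s_def)
  moreover have "(\<integral>y. s k y \<partial>lborel) = 0" for k
    unfolding s_def
  proof (rule integral_cos_sinc_prod_eq_0)
    have "(\<Sum>i<k + (m + 2). b i) \<le> suminf b"
      using b less_imp_le by (intro sum_le_suminf) auto
    thus "2 * (\<Sum>i<k + (m + 2). b i) \<le> c" using c by simp
  qed (use b in auto)
  ultimately show ?thesis by (simp add: LIMSEQ_const_iff)
qed

section \<open>A perturbation of the density with vanishing moments\<close>

lemma even_integral_half_line:
  fixes u :: "real \<Rightarrow> real"
  assumes int: "integrable lborel u" and even: "\<And>y. u (- y) = u y"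
  shows "set_integrable lborel {0<..} u"
    and "2 * (LINT y:{0<..}|lborel. u y) = (\<integral>y. u y \<partial>lborel)"
proof -
  have pos: "integrable lborel (\<lambda>y. indicator {0<..} y * u y)"
    using integrable_mult_indicator[OF _ int, of "{0<..}"] by simp
  thus "set_integrable lborel {0<..} u" by (simp add: set_integrable_def)
  have neg: "integrable lborel (\<lambda>y. indicator {..<0} y * u y)"
    using integrable_mult_indicator[OF _ int, of "{..<0}"] by simp
  have "(\<integral>y. indicator {0<..} y * u y \<partial>lborel) = (\<integral>y. indicator {0<..} (0 + (-1) * y) * u (0 + (-1) * y) \<partial>lborel)"
    by (subst lborel_integral_real_affine[of "-1" _ 0]) simp_all
  also have "\<dots> = (\<integral>y. indicator {..<0} y * u y \<partial>lborel)"
    by (intro Bochner_Integration.integral_cong) (auto simp: indicator_def even)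
  finally have eq: "(\<integral>y. indicator {0<..} y * u y \<partial>lborel) = (\<integral>y. indicator {..<0} y * u y \<partial>lborel)" .
  have "(\<integral>y. u y \<partial>lborel) = (\<integral>y. indicator {0<..} y * u y + indicator {..<0} y * u y \<partial>lborel)"
    using int AE_lborel_singleton[of 0]
    by (intro integral_cong_AE) (auto simp: indicator_def elim!: eventually_mono)
  also have "\<dots> = 2 * (\<integral>y. indicator {0<..} y * u y \<partial>lborel)"
    using pos neg eq by simp
  finally show "2 * (LINT y:{0<..}|lborel. u y) = (\<integral>y. u y \<partial>lborel)"
    by (simp add: set_lebesgue_integral_def)
qed

text \<open>The change of variables theorem is phrased with Lebesgue measurable sets and gauge
  integrals, the densities with Borel measure; this passes between the two.\<close>

lemma borel_absolutely_integrable_iff: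
  fixes F :: "real \<Rightarrow> real"
  assumes [measurable]: "F \<in> borel_measurable borel" "S \<in> sets borel"
  shows "F absolutely_integrable_on S \<longleftrightarrow> set_integrable lborel S F"
  unfolding set_integrable_def by (intro integrable_completion) measurable

lemma image_add_square: "0 \<le> a \<Longrightarrow> (\<lambda>y::real. a + y\<^sup>2) ` {0<..} = {a<..}"
proof (intro equalityI subsetI)
  fix x assume "x \<in> {a<..}"
  thus "x \<in> (\<lambda>y::real. a + y\<^sup>2) ` {0<..}"
    by (intro image_eqI[of _ _ "sqrt (x - a)"]) auto
qed auto

text \<open>Under \<open>x = x0 + y\<^sup>2\<close> the square root and the Jacobian contribute one
  factor \<open>y\<close> each, and the binomial expansion of \<open>(x0 + y\<^sup>2) ^ n\<close>
  has only even powers. Every term is thus an even function whose integral over the line is known to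
  vanish.\<close>

lemma integral_perturbation_eq_0:
  fixes n :: nat and b :: "nat \<Rightarrow> real" and \<epsilon> c x0 :: real
  assumes x0: "0 < x0" and b: "\<And>i. 0 < b i" "summable b" and c: "2 * suminf b \<le> c"
  defines "h \<equiv> \<lambda>x. if x0 < x then \<epsilon> * (sqrt (x - x0) * cos (c * sqrt (x - x0)) * sinc_inf_prod b (sqrt (x - x0))) else 0"
  shows "(\<integral>x. x ^ n * h x \<partial>lborel) = 0"
proof -
  define u where "u j y = y ^ (2 * j + 2) * cos (c * y) * sinc_inf_prod b y" for j :: nat and y
  have u: "set_integrable lborel {0<..} (u j)" "(LINT y:{0<..}|lborel. u j y) = 0" for j
  proof -
    have int: "integrable lborel (u j)"
      unfolding u_def by (rule integrable_cos_sinc_inf_prod[OF b(1)])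
    have zero: "(\<integral>y. u j y \<partial>lborel) = 0"
      unfolding u_def by (rule integral_cos_sinc_inf_prod_eq_0[OF b c])
    have even: "u j (- y) = u j y" for y
      by (simp add: u_def sinc_inf_prod_even)
    show "set_integrable lborel {0<..} (u j)" "(LINT y:{0<..}|lborel. u j y) = 0"
      using even_integral_half_line[OF int even] zero by auto
  qed
  have hm[measurable]: "h \<in> borel_measurable borel"
    unfolding h_def by measurable
  define F where "F x = x ^ n * h x" for x
  have Fm[measurable]: "F \<in> borel_measurable borel"
    unfolding F_def[abs_def] by measurable
  define w where "w y = (\<Sum>j\<le>n. (2 * \<epsilon> * real (n choose j) * x0 ^ (n - j)) * u j y)" for y
  have w: "w y = \<bar>2 * y\<bar> * F (x0 + y\<^sup>2)" if "0 < y" for y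
  proof -
    have "\<bar>2 * y\<bar> * F (x0 + y\<^sup>2) = 2 * \<epsilon> * (y\<^sup>2 + x0) ^ n * (y\<^sup>2 * cos (c * y) * sinc_inf_prod b y)"
      using that by (simp add: F_def h_def power2_eq_square add.commute)
    also have "\<dots> = (\<Sum>j\<le>n. 2 * \<epsilon> * (real (n choose j) * (y\<^sup>2) ^ j * x0 ^ (n - j)) * (y\<^sup>2 * cos (c * y) * sinc_inf_prod b y))"
      unfolding binomial_ring by (simp add: sum_distrib_left sum_distrib_right)
    also have "\<dots> = w y"
      unfolding w_def u_def by (intro sum.cong) (auto simp: power_add power_mult power_mult_distrib mult_ac power2_eq_square)
    finally show ?thesis by simp
  qed
  have intw: "set_integrable lborel {0<..} w"
    unfolding w_def using u(1) unfolding set_integrable_def scaleR_sum_right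
    by (intro Bochner_Integration.integrable_sum) (simp add: mult.left_commute[of "indicator _ _"])
  have "(LINT y:{0<..}|lborel. w y) = (\<Sum>j\<le>n. (2 * \<epsilon> * real (n choose j) * x0 ^ (n - j)) * (LINT y:{0<..}|lborel. u j y))"
    unfolding w_def using u(1) unfolding set_lebesgue_integral_def set_integrable_def scaleR_sum_right
    by (subst Bochner_Integration.integral_sum) (simp_all add: mult.left_commute[of "indicator _ _"])
  hence zero: "(LINT y:{0<..}|lborel. w y) = 0" by (simp add: u(2))
  have intW: "set_integrable lborel {0<..} (\<lambda>y. \<bar>2 * y\<bar> * F (x0 + y\<^sup>2))"
    and zeroW: "(LINT y:{0<..}|lborel. \<bar>2 * y\<bar> * F (x0 + y\<^sup>2)) = 0"
  proof -
    have *: "indicator {0<..} y *\<^sub>R (\<bar>2 * y\<bar> * F (x0 + y\<^sup>2)) = indicator {0<..} y *\<^sub>R w y" for y :: real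
      using w[of y] by (auto simp: indicator_def)
    thus "set_integrable lborel {0<..} (\<lambda>y. \<bar>2 * y\<bar> * F (x0 + y\<^sup>2))"
        "(LINT y:{0<..}|lborel. \<bar>2 * y\<bar> * F (x0 + y\<^sup>2)) = 0"
      using intw zero unfolding set_integrable_def set_lebesgue_integral_def * by auto
  qed
  have "(\<lambda>y. \<bar>2 * y\<bar> * F (x0 + y\<^sup>2)) absolutely_integrable_on {0<..} \<and>
      integral {0<..} (\<lambda>y. \<bar>2 * y\<bar> * F (x0 + y\<^sup>2)) = 0"
    using intW zeroW set_borel_integral_eq_integral[OF intW]
    by (subst borel_absolutely_integrable_iff) auto
  hence F: "F absolutely_integrable_on {x0<..}" "integral {x0<..} F = 0"
    unfolding image_add_square[OF less_imp_le[OF x0], symmetric]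
    by (subst (asm) has_absolute_integral_change_of_variables_1'; force intro!: derivative_eq_intros simp: inj_on_def)+
  have "set_integrable lborel {x0<..} F"
    using F(1) by (subst (asm) borel_absolutely_integrable_iff) auto
  from set_borel_integral_eq_integral(2)[OF this] F(2)
  have "(LINT x:{x0<..}|lborel. F x) = 0" by simp
  moreover have "(LINT x:{x0<..}|lborel. F x) = (\<integral>x. F x \<partial>lborel)"
    unfolding set_lebesgue_integral_def by (intro Bochner_Integration.integral_cong) (auto simp: F_def h_def indicator_def)
  ultimately show ?thesis by (simp add: F_def)
qed

text \<open>The competitor has density \<open>f + h\<close>, nonnegative because \<open>h\<close>
  oscillates below \<open>f\<close> in modulus. It differs from \<open>f\<close> because the cosine
  and the product are both positive just above \<open>x0\<close>.\<close>

lemma moment_indeterminate_if_density_ge: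
  fixes \<nu> :: "real measure" and f :: "real \<Rightarrow> real" and b :: "nat \<Rightarrow> real"
  assumes \<nu>: "half_line_measure \<nu>" "finite_moments \<nu>" and f: "is_density \<nu> f"
    and x0: "0 < x0" and b: "\<And>i. 0 < b i" "summable b" and \<epsilon>: "0 < \<epsilon>"
    and bound: "\<And>x. x0 < x \<Longrightarrow> \<epsilon> * (sqrt (x - x0) * sinc_inf_prod b (sqrt (x - x0))) \<le> f x"
  shows "moment_indeterminate \<nu>"
proof -
  define c where "c = 2 * suminf b"
  have c0: "0 < c" unfolding c_def using suminf_pos[OF b(2,1)] by simp
  have f0: "\<And>x. 0 \<le> f x" and fm[measurable]: "f \<in> borel_measurable borel" and fd: "\<nu> = density lborel f"
    using f by (auto simp: is_density_def)
  define h where "h = (\<lambda>x. if x0 < x then \<epsilon> * (sqrt (x - x0) * cos (c * sqrt (x - x0)) * sinc_inf_prod b (sqrt (x - x0))) else 0)"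
  have hm[measurable]: "h \<in> borel_measurable borel"
    unfolding h_def by measurable
  have h_le: "\<bar>h x\<bar> \<le> f x" for x
  proof (cases "x0 < x")
    case True
    define y where "y = sqrt (x - x0)"
    have y0: "0 < y" using True by (simp add: y_def)
    have "\<bar>h x\<bar> = \<epsilon> * (y * \<bar>cos (c * y)\<bar> * sinc_inf_prod b y)"
      using True \<epsilon> y0 sinc_inf_prod_nonneg[of b y] by (simp add: h_def y_def[symmetric] abs_mult)
    also have "\<dots> \<le> \<epsilon> * (y * 1 * sinc_inf_prod b y)"
      using \<epsilon> y0 sinc_inf_prod_nonneg[of b y] by (intro mult_left_mono mult_right_mono) auto
    also have "\<dots> \<le> f x" using bound[OF True] by (simp add: y_def)
    finally show ?thesis .
  qed (use f0 in \<open>auto simp: h_def\<close>)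
  have fh0: "0 \<le> f x + h x" for x using h_le[of x] by linarith
  define \<mu> where "\<mu> = density lborel (\<lambda>x. ennreal (f x + h x))"
  have int_f: "integrable lborel (\<lambda>x. x ^ n * f x)" for n
    using \<nu>(2) f0 unfolding finite_moments_def fd
    by (auto simp: integrable_density mult.commute)
  have int_h: "integrable lborel (\<lambda>x. x ^ n * h x)" for n
  proof (rule Bochner_Integration.integrable_bound[OF int_f[of n]])
    show "AE x in lborel. norm (x ^ n * h x) \<le> norm (x ^ n * f x)"
      using h_le f0 by (intro AE_I2) (simp add: abs_mult mult_left_mono)
  qed measurable
  have "emeasure \<mu> {..<0} = emeasure \<nu> {..<0}"
    unfolding \<mu>_def fd using x0
    by (auto simp: emeasure_density h_def indicator_def intro!: nn_integral_cong)
  hence "half_line_measure \<mu>"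
    using \<nu>(1) by (simp add: half_line_measure_def \<mu>_def)
  moreover have "finite_moments \<mu>"
    unfolding finite_moments_def \<mu>_def
    using fh0 int_f int_h by (auto simp: integrable_density algebra_simps)
  moreover have "(\<integral>x. x ^ n \<partial>\<mu>) = (\<integral>x. x ^ n \<partial>\<nu>)" for n :: nat
  proof -
    have "(\<integral>x. x ^ n \<partial>\<mu>) = (\<integral>x. x ^ n * f x + x ^ n * h x \<partial>lborel)"
      unfolding \<mu>_def using fh0 by (subst integral_density) (auto simp: algebra_simps)
    also have "\<dots> = (\<integral>x. x ^ n * f x \<partial>lborel) + (\<integral>x. x ^ n * h x \<partial>lborel)"
      by (rule Bochner_Integration.integral_add[OF int_f int_h])
    also have "(\<integral>x. x ^ n * h x \<partial>lborel) = 0"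
      unfolding h_def by (rule integral_perturbation_eq_0[OF x0 b]) (simp add: c_def)
    also have "(\<integral>x. x ^ n * f x \<partial>lborel) = (\<integral>x. x ^ n \<partial>\<nu>)"
      unfolding fd using f0 by (subst integral_density) (auto simp: mult.commute)
    finally show ?thesis by simp
  qed
  moreover have "\<mu> \<noteq> \<nu>"
  proof
    assume "\<mu> = \<nu>"
    hence "AE x in lborel. ennreal (f x + h x) = ennreal (f x)"
      unfolding \<mu>_def fd by (subst (asm) sigma_finite_measure.density_unique_iff[OF sigma_finite_lborel]) auto
    hence AE: "AE x in lborel. h x = 0"
    proof eventually_elim
      case (elim x)
      thus ?case using ennreal_inj[OF fh0 f0, of x x] by simp
    qed
    define B where "B = suminf b"
    have B0: "0 < B" unfolding B_def by (rule suminf_pos[OF b(2,1)])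
    \<comment> \<open>For \<open>0 < y < d\<close>, \<open>c * y < 1\<close> keeps the cosine
      positive and \<open>B * y < 1 / 2\<close> keeps the lower bound in
      \<open>sinc_inf_prod_ge\<close> positive.\<close>
    define d where "d = min (1 / c) (1 / (2 * B))"
    have d0: "0 < d" using c0 B0 by (simp add: d_def)
    have "h x \<noteq> 0" if "x \<in> {x0<..<x0 + d\<^sup>2}" for x
    proof -
      define y where "y = sqrt (x - x0)"
      have y: "0 < y" "y < d"
        using that d0 by (auto simp: y_def intro!: real_less_lsqrt)
      have "c * y < c * (1 / c)" using y c0 by (intro mult_strict_left_mono) (auto simp: d_def)
      hence "0 < cos (c * y)" using c0 y pi_gt3 by (intro cos_gt_zero_pi) (auto intro: less_trans[of _ 0])
      moreover have "0 < sinc_inf_prod b y"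
      proof -
        have "B * y < B * (1 / (2 * B))" using y B0 by (intro mult_strict_left_mono) (auto simp: d_def)
        hence "(B * y)\<^sup>2 < 1" using B0 y by (simp add: abs_square_less_1)
        thus ?thesis using sinc_inf_prod_ge[OF b, of y] by (simp add: B_def power_mult_distrib)
      qed
      ultimately show ?thesis using that y \<epsilon> by (simp add: h_def y_def[symmetric])
    qed
    hence "AE x in lborel. x \<notin> {x0<..<x0 + d\<^sup>2}"
      using AE by (auto elim!: eventually_mono)
    hence "emeasure lborel {x0<..<x0 + d\<^sup>2} = 0"
      by (subst (asm) AE_iff_null_sets[symmetric]) auto
    thus False using d0 by simp
  qed
  ultimately show ?thesis
    unfolding moment_indeterminate_def moment_determinate_def by blast
qed

section \<open>The series and the integrals\<close>

text \<open>The choice \<open>p = 0\<close>, \<open>q = 1\<close> is a positive part; general values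
  cover the linear error between \<open>G\<close> and the sum of positive parts.\<close>

lemma nn_integral_exp_tail:
  fixes B :: real
  assumes "0 \<le> p" "0 \<le> q"
  shows "(\<integral>\<^sup>+u. ennreal ((p + q * (u - B)) * exp (- u / 2)) * indicator {B..} u \<partial>lborel)
    = ennreal ((2 * p + 4 * q) * exp (- B / 2))"
proof -
  have "(\<integral>\<^sup>+u. ennreal ((p + q * (u - B)) * exp (- u / 2)) * indicator {B..} u \<partial>lborel)
      = ennreal (0 - (- (2 * (p + q * (B - B)) + 4 * q) * exp (- B / 2)))"
  proof (rule nn_integral_FTC_atLeast[where F = "\<lambda>u. - (2 * (p + q * (u - B)) + 4 * q) * exp (- u / 2)"])
    fix u assume "B \<le> u"
    show "((\<lambda>u. - (2 * (p + q * (u - B)) + 4 * q) * exp (- u / 2)) has_real_derivative (p + q * (u - B)) * exp (- u / 2)) (at u)"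
      by (auto intro!: derivative_eq_intros simp: algebra_simps)
    show "0 \<le> (p + q * (u - B)) * exp (- u / 2)"
      using assms \<open>B \<le> u\<close> by simp
  next
    show "((\<lambda>u. - (2 * (p + q * (u - B)) + 4 * q) * exp (- u / 2)) \<longlongrightarrow> 0) at_top"
      by real_asymp
  qed simp
  thus ?thesis by (simp add: algebra_simps)
qed

lemma finite_integral_at_top_iff:
  "finite_integral_at_top f \<longleftrightarrow> (\<exists>S\<ge>s. set_integrable lborel {S..} f)"
proof
  assume "finite_integral_at_top f"
  then obtain S where "\<And>A. S \<le> A \<Longrightarrow> set_integrable lborel {A..} f"
    by (auto simp: finite_integral_at_top_def eventually_at_top_linorder)
  thus "\<exists>S\<ge>s. set_integrable lborel {S..} f" by (intro exI[of _ "max s S"]) auto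
next
  assume "\<exists>S\<ge>s. set_integrable lborel {S..} f"
  then obtain S where S: "set_integrable lborel {S..} f" by blast
  show "finite_integral_at_top f"
    unfolding finite_integral_at_top_def eventually_at_top_linorder
    by (intro exI[of _ S] allI impI set_integrable_subset[OF S]) auto
qed

lemma finite_sum_at_top_iff: "finite_sum_at_top f \<longleftrightarrow> summable (\<lambda>n. f (n + N))"
  by (simp add: finite_sum_at_top_def summable_iff_shift)

context convex_legendre
begin

definition V :: "nat \<Rightarrow> real" where "V j = v (real (j + N))"

text \<open>For \<open>V k \<le> u \<le> V (Suc k)\<close> this is the sum of the positive parts of
  all \<open>u - V j\<close>, a convex piecewise linear function whose slope grows by one at each
  \<open>V j\<close>.\<close>

definition K :: "nat \<Rightarrow> real \<Rightarrow> real" where "K k u = (\<Sum>j\<le>k. u - V j)"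

lemma V_ge: "A \<le> V j"
  unfolding V_def by (rule v_ge) simp

lemma g_V: "g (V j) = real (j + N)"
  unfolding V_def by (rule g_v) simp

lemma V_mono: "i \<le> j \<Longrightarrow> V i \<le> V j"
  unfolding V_def by (rule v_mono) auto

lemma g_mono: "A \<le> u \<Longrightarrow> u \<le> w \<Longrightarrow> g u \<le> g w"
  using g_strict[of u w] by (cases "u = w") auto

text \<open>The index is read off the integer part of the slope \<open>g u\<close>, since
  \<open>V k\<close> is the point where the slope equals \<open>k + N\<close>.\<close>

lemma ex_V_interval:
  assumes "V 0 \<le> u"
  shows "\<exists>k. V k \<le> u \<and> u \<le> V (Suc k)"
proof -
  define k where "k = nat \<lfloor>g u\<rfloor> - N"
  have u: "A \<le> u" using assms V_ge[of 0] by simp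
  have "real N \<le> g u" using g_mono[OF V_ge assms] by (simp add: g_V)
  hence "int N \<le> \<lfloor>g u\<rfloor>" by (simp add: le_floor_iff)
  hence k: "real (k + N) \<le> g u" "g u \<le> real (Suc k + N)"
    unfolding k_def by linarith+
  have "V k \<le> u"
    using g_strict[OF u, of "V k"] g_V[of k] k(1) by linarith
  moreover have "u \<le> V (Suc k)"
    unfolding V_def using u k(2) by (intro le_v) auto
  ultimately show ?thesis by blast
qed

text \<open>
  Between \<open>V k\<close> and \<open>V (Suc k)\<close> the slope of \<open>G\<close> lies between \<open>k + N\<close> and \<open>k + N + 1\<close>, while \<open>K k\<close> has
  slope \<open>k + 1\<close>.
\<close>

lemma G_minus_K_bounds:
  assumes "V k \<le> u" "u \<le> V (Suc k)"
  shows "G (V 0) + (real N - 1) * (u - V 0) \<le> G u - K k u \<and> G u - K k u \<le> G (V 0) + real N * (u - V 0)"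
  using assms
proof (induction k arbitrary: u)
  \<comment> \<open>The lower bound is the tangent at \<open>V k\<close>; the upper one is the
    tangent at \<open>u\<close>, whose slope is at most that at \<open>V (Suc k)\<close>.\<close>
  have step: "G (V k) + real (k + N) * (u - V k) \<le> G u \<and> G u \<le> G (V k) + real (Suc k + N) * (u - V k)"
    if "V k \<le> u" "u \<le> V (Suc k)" for k u
  proof
    have u: "A \<le> u" using that V_ge[of k] by simp
    show "G (V k) + real (k + N) * (u - V k) \<le> G u"
      using tangent[OF V_ge u, of k] by (simp add: g_V)
    have "g u \<le> real (Suc k + N)" using g_mono[OF u that(2)] by (simp add: g_V)
    hence "g u * (u - V k) \<le> real (Suc k + N) * (u - V k)"
      using that by (intro mult_right_mono) auto
    thus "G u \<le> G (V k) + real (Suc k + N) * (u - V k)"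
      using tangent[OF u V_ge, of k] by (simp add: algebra_simps)
  qed
  {
    case 0
    from step[OF this] show ?case by (simp add: K_def algebra_simps)
  next
    case (Suc k)
    define w where "w = V (Suc k)"
    have "V k \<le> w" unfolding w_def by (rule V_mono) simp
    with Suc.IH[of w] have IH: "G (V 0) + (real N - 1) * (w - V 0) \<le> G w - K k w"
      "G w - K k w \<le> G (V 0) + real N * (w - V 0)"
      by (auto simp: w_def)
    \<comment> \<open>The new summand vanishes at \<open>w\<close>, so \<open>K\<close> continues
      from there with slope \<open>k + 2\<close>, against a slope of \<open>G\<close> between
      \<open>k + 1 + N\<close> and \<open>k + 2 + N\<close>.\<close>
    have "K (Suc k) u = K k w + (real k + 2) * (u - w)"
      by (simp add: K_def w_def sum_subtractf algebra_simps)
    with step[OF Suc.prems] IH show ?case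
      unfolding w_def[symmetric] by (simp add: algebra_simps)
  }
qed

lemma sum_le_G: "V 0 \<le> u \<Longrightarrow> (\<Sum>j\<le>n. max 0 (u - V j)) \<le> G u"
proof -
  assume u: "V 0 \<le> u"
  then obtain k where k: "V k \<le> u" "u \<le> V (Suc k)" using ex_V_interval by blast
  have "(\<Sum>j\<le>n. max 0 (u - V j)) \<le> (\<Sum>j\<le>n. if j \<le> k then u - V j else 0)"
  proof (intro sum_mono)
    fix j
    show "max 0 (u - V j) \<le> (if j \<le> k then u - V j else 0)"
      using k V_mono[of j k] V_mono[of "Suc k" j] by (cases "j \<le> k") auto
  qed
  also have "\<dots> = (\<Sum>j\<in>{..n} \<inter> {..k}. u - V j)"
    by (subst sum.inter_restrict) auto
  also have "\<dots> \<le> K k u"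
    unfolding K_def using k V_mono[of _ k] by (intro sum_mono2) (auto intro: order_trans)
  also have "\<dots> \<le> G u"
  proof -
    have "0 \<le> (real N - 1) * (u - V 0)" using N_ge u by simp
    thus ?thesis using G_minus_K_bounds[OF k] G_nonneg[OF V_ge[of 0]] by linarith
  qed
  finally show ?thesis .
qed

lemma indicator_G_measurable: "(\<lambda>u. indicator {A..} u * (G u * exp (- u / 2))) \<in> borel_measurable borel"
proof -
  have "continuous_on {A..} (\<lambda>u. G u * exp (- u / 2))"
    by (intro continuous_intros G_cont) simp
  from borel_measurable_continuous_on_indicator[OF _ this] show ?thesis by simp
qed

text \<open>The two bounds in \<open>G_minus_K_bounds\<close> serve one direction each: the positive
  parts sum to at most \<open>G\<close>, and \<open>G\<close> is at most their sum plus a linear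
  function, which is integrable against \<open>exp (- u / 2)\<close>.\<close>

lemma summable_iff_integrable:
  "summable (\<lambda>j. exp (- (1/2) * V j)) \<longleftrightarrow> set_integrable lborel {A..} (\<lambda>u. G u * exp (- u / 2))"
proof
  assume int: "set_integrable lborel {A..} (\<lambda>u. G u * exp (- u / 2))"
  define I where "I = (\<integral>u. indicator {A..} u * (G u * exp (- u / 2)) \<partial>lborel)"
  have I: "(\<integral>\<^sup>+u. ennreal (indicator {A..} u * (G u * exp (- u / 2))) \<partial>lborel) = ennreal I"
    using int G_nonneg unfolding I_def set_integrable_def
    by (intro nn_integral_eq_integral) (auto simp: indicator_def)
  have "(\<Sum>j\<le>n. norm (exp (- (1/2) * V j))) \<le> I" for n
  proof -
    have "ennreal (\<Sum>j\<le>n. 4 * exp (- V j / 2)) = (\<Sum>j\<le>n. ennreal (4 * exp (- V j / 2)))"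
      by (intro sum_ennreal[symmetric]) simp
    also have "\<dots> = (\<Sum>j\<le>n. \<integral>\<^sup>+u. ennreal ((0 + 1 * (u - V j)) * exp (- u / 2)) * indicator {V j..} u \<partial>lborel)"
      by (subst nn_integral_exp_tail) simp_all
    also have "\<dots> = (\<integral>\<^sup>+u. (\<Sum>j\<le>n. ennreal ((0 + 1 * (u - V j)) * exp (- u / 2)) * indicator {V j..} u) \<partial>lborel)"
      by (subst nn_integral_sum) auto
    also have "\<dots> \<le> (\<integral>\<^sup>+u. ennreal (indicator {A..} u * (G u * exp (- u / 2))) \<partial>lborel)"
    proof (rule nn_integral_mono)
      fix u
      have "(\<Sum>j\<le>n. ennreal ((0 + 1 * (u - V j)) * exp (- u / 2)) * indicator {V j..} u)
          = (\<Sum>j\<le>n. ennreal (max 0 (u - V j) * exp (- u / 2)))"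
        by (intro sum.cong) (auto simp: indicator_def)
      also have "\<dots> = ennreal ((\<Sum>j\<le>n. max 0 (u - V j)) * exp (- u / 2))"
        by (subst sum_ennreal) (auto simp: sum_distrib_right)
      also have "\<dots> \<le> ennreal (indicator {A..} u * (G u * exp (- u / 2)))"
      proof (cases "V 0 \<le> u")
        case True
        thus ?thesis using sum_le_G[of u n] V_ge[of 0] by (auto intro!: ennreal_leI mult_right_mono)
      next
        case False
        have "max 0 (u - V j) = 0" for j using False V_mono[of 0 j] by simp
        thus ?thesis by simp
      qed
      finally show "(\<Sum>j\<le>n. ennreal ((0 + 1 * (u - V j)) * exp (- u / 2)) * indicator {V j..} u)
          \<le> ennreal (indicator {A..} u * (G u * exp (- u / 2)))" .
    qed
    also have "\<dots> = ennreal I" by (rule I)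
    finally have "(\<Sum>j\<le>n. 4 * exp (- V j / 2)) \<le> I"
      by (subst (asm) ennreal_le_iff) (use G_nonneg in \<open>auto simp: I_def indicator_def intro!: integral_nonneg_AE\<close>)
    moreover have "(\<Sum>j\<le>n. norm (exp (- (1/2) * V j))) \<le> (\<Sum>j\<le>n. 4 * exp (- V j / 2))"
      by (intro sum_mono) simp
    ultimately show ?thesis by linarith
  qed
  thus "summable (\<lambda>j. exp (- (1/2) * V j))"
    by (intro bounded_imp_summable[of _ I]) auto
next
  assume summ: "summable (\<lambda>j. exp (- (1/2) * V j))"
  define B where "B = V 0"
  have B: "A \<le> B" unfolding B_def by (rule V_ge)
  define p where "p = G B"
  have p0: "0 \<le> p" unfolding p_def using B by (rule G_nonneg)
  have cont: "continuous_on {A..} (\<lambda>u. G u * exp (- u / 2))"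
    by (intro continuous_intros G_cont) simp
  have "set_integrable lborel {A..B} (\<lambda>u. G u * exp (- u / 2))"
    unfolding set_integrable_def by (intro borel_integrable_compact continuous_on_subset[OF cont]) auto
  moreover have "set_integrable lborel {B..} (\<lambda>u. G u * exp (- u / 2))"
    unfolding set_integrable_def
  proof (rule integrableI_nonneg)
    have "(\<lambda>u. indicator {B..} u *\<^sub>R (G u * exp (- u / 2))) = (\<lambda>u. indicator {B..} u * (indicator {A..} u * (G u * exp (- u / 2))))"
      using B by (auto simp: indicator_def fun_eq_iff)
    thus "(\<lambda>u. indicator {B..} u *\<^sub>R (G u * exp (- u / 2))) \<in> borel_measurable lborel"
      using indicator_G_measurable by simp
    show "AE u in lborel. 0 \<le> indicator {B..} u *\<^sub>R (G u * exp (- u / 2))"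
      using G_nonneg B by (intro AE_I2) (auto simp: indicator_def)
    have "(\<integral>\<^sup>+u. ennreal (indicator {B..} u *\<^sub>R (G u * exp (- u / 2))) \<partial>lborel)
      \<le> (\<integral>\<^sup>+u. (\<Sum>j. ennreal ((0 + 1 * (u - V j)) * exp (- u / 2)) * indicator {V j..} u)
          + ennreal ((p + real N * (u - B)) * exp (- u / 2)) * indicator {B..} u \<partial>lborel)"
    proof (rule nn_integral_mono)
      fix u
      show "ennreal (indicator {B..} u *\<^sub>R (G u * exp (- u / 2)))
        \<le> (\<Sum>j. ennreal ((0 + 1 * (u - V j)) * exp (- u / 2)) * indicator {V j..} u)
          + ennreal ((p + real N * (u - B)) * exp (- u / 2)) * indicator {B..} u"
      proof (cases "B \<le> u")
        case True
        then obtain k where k: "V k \<le> u" "u \<le> V (Suc k)" using ex_V_interval unfolding B_def by blast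
        have K0: "0 \<le> K k u"
          unfolding K_def using k(1) V_mono[of _ k] by (intro sum_nonneg) (auto intro: order_trans)
        have "G u * exp (- u / 2) \<le> (K k u + (p + real N * (u - B))) * exp (- u / 2)"
          using G_minus_K_bounds[OF k] by (intro mult_right_mono) (auto simp: p_def B_def)
        hence "ennreal (G u * exp (- u / 2)) \<le> ennreal (K k u * exp (- u / 2) + (p + real N * (u - B)) * exp (- u / 2))"
          by (intro ennreal_leI) (simp add: algebra_simps)
        also have "\<dots> = ennreal (K k u * exp (- u / 2)) + ennreal ((p + real N * (u - B)) * exp (- u / 2))"
          using K0 p0 True by (intro ennreal_plus) auto
        also have "ennreal (K k u * exp (- u / 2)) = (\<Sum>j\<le>k. ennreal ((0 + 1 * (u - V j)) * exp (- u / 2)) * indicator {V j..} u)"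
        proof -
          have le: "V j \<le> u" if "j \<le> k" for j using k(1) V_mono[OF that] by simp
          have "ennreal (K k u * exp (- u / 2)) = (\<Sum>j\<le>k. ennreal ((u - V j) * exp (- u / 2)))"
            using le by (subst sum_ennreal) (auto simp: K_def sum_distrib_right)
          thus ?thesis using le by simp
        qed
        also have "\<dots> \<le> (\<Sum>j. ennreal ((0 + 1 * (u - V j)) * exp (- u / 2)) * indicator {V j..} u)"
          by (rule sum_le_suminf) auto
        finally show ?thesis using True by (simp add: add_right_mono)
      qed simp
    qed
    also have "\<dots> = (\<Sum>j. ennreal ((2 * 0 + 4 * 1) * exp (- V j / 2))) + ennreal ((2 * p + 4 * real N) * exp (- B / 2))"
    proof -
      have "(\<integral>\<^sup>+u. ennreal ((p + real N * (u - B)) * exp (- u / 2)) * indicator {B..} u \<partial>lborel)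
          = ennreal ((2 * p + 4 * real N) * exp (- B / 2))"
        by (rule nn_integral_exp_tail) (use p0 in auto)
      moreover have "(\<integral>\<^sup>+u. ennreal ((0 + 1 * (u - V j)) * exp (- u / 2)) * indicator {V j..} u \<partial>lborel)
          = ennreal ((2 * 0 + 4 * 1) * exp (- V j / 2))" for j
        by (rule nn_integral_exp_tail) auto
      moreover have "(\<integral>\<^sup>+u. (\<Sum>j. ennreal ((0 + 1 * (u - V j)) * exp (- u / 2)) * indicator {V j..} u) \<partial>lborel)
          = (\<Sum>j. \<integral>\<^sup>+u. ennreal ((0 + 1 * (u - V j)) * exp (- u / 2)) * indicator {V j..} u \<partial>lborel)"
        by (rule nn_integral_suminf) measurable
      moreover have "(\<lambda>u. \<Sum>j. ennreal ((0 + 1 * (u - V j)) * exp (- u / 2)) * indicator {V j..} u) \<in> borel_measurable lborel"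
        "(\<lambda>u. ennreal ((p + real N * (u - B)) * exp (- u / 2)) * indicator {B..} u) \<in> borel_measurable lborel"
        by measurable
      ultimately show ?thesis
        by (simp only: nn_integral_add)
    qed
    also have "(\<Sum>j. ennreal ((2 * 0 + 4 * 1) * exp (- V j / 2))) = ennreal (\<Sum>j. 4 * exp (- (1/2) * V j))"
      using summable_mult[OF summ, of 4] by (subst suminf_ennreal2[symmetric]) auto
    also have "\<dots> + ennreal ((2 * p + 4 * real N) * exp (- B / 2)) < \<infinity>" by simp
    finally show "(\<integral>\<^sup>+u. ennreal (indicator {B..} u *\<^sub>R (G u * exp (- u / 2))) \<partial>lborel) < \<infinity>" .
  qed
  ultimately have "set_integrable lborel ({A..B} \<union> {B..}) (\<lambda>u. G u * exp (- u / 2))"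
    by (intro set_integrable_Un) auto
  moreover have "{A..B} \<union> {B..} = {A..}" using B by auto
  ultimately show "set_integrable lborel {A..} (\<lambda>u. G u * exp (- u / 2))" by simp
qed

end

section \<open>Indeterminacy from a convergent series, and the logarithmic integral\<close>

context convex_legendre
begin

text \<open>At large \<open>x\<close> the product is cut after the factors with \<open>V j\<close>
  below \<open>ln x\<close>. Each of these is at most \<open>exp (V j - ln x)\<close>, so together
  they give \<open>exp (- K k (ln x))\<close>, which matches \<open>exp (- G (ln x))\<close> up to a
  power of \<open>x\<close>.\<close>

lemma indeterminate_if_summable:
  assumes \<nu>: "half_line_measure \<nu>" "finite_moments \<nu>" and f: "is_density \<nu> f"
    and c: "0 < c" and lower: "\<And>x. x1 \<le> x \<Longrightarrow> c * exp (- G (ln x)) \<le> f x"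
    and summ: "summable (\<lambda>j. exp (- (1/2) * V j))"
  shows "moment_indeterminate \<nu>"
proof -
  define x0 where "x0 = max x1 (exp A)"
  have x0: "x1 \<le> x0" "exp A \<le> x0" by (auto simp: x0_def)
  have x0_pos: "0 < x0" using exp_gt_zero[of A] x0(2) by linarith
  \<comment> \<open>The first \<open>q\<close> factors compensate the linear term \<open>N u\<close> by which \<open>K\<close> may fall short of \<open>G\<close>; the
      factor \<open>sqrt 2\<close> compensates \<open>(sqrt (x - x0))\<^sup>2 \<ge> x / 2\<close>, valid for \<open>x \<ge> 2 x0\<close>.\<close>
  define q where "q = N + 1"
  define b where "b i = (if i < q then 1 else sqrt 2 * exp (- (1/2) * V (i - q)))" for i
  have b_pos: "0 < b i" for i by (simp add: b_def)
  have "summable (\<lambda>i. b (i + q))"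
    using summable_mult[OF summ, of "sqrt 2"] by (simp add: b_def)
  hence b_summ: "summable b" by (simp add: summable_iff_shift)
  have prod_b: "(\<Prod>i<q + n. inverse ((b i * y)\<^sup>2)) = inverse (y ^ (2 * q)) * (\<Prod>j<n. inverse (2 * exp (- V j) * y\<^sup>2))" for n y
  proof (induction n)
    case 0
    have "(\<Prod>i<q. inverse ((b i * y)\<^sup>2)) = (\<Prod>i<q. inverse (y\<^sup>2))"
      by (intro prod.cong) (auto simp: b_def)
    thus ?case by (simp add: power_mult power_inverse)
  next
    case (Suc n)
    have "(b (q + n) * y)\<^sup>2 = 2 * exp (- V n) * y\<^sup>2"
      by (simp add: b_def power_mult_distrib exp_double[symmetric])
    with Suc show ?case by (simp add: mult.assoc)
  qed
  \<comment> \<open>The three entries guarantee, in this order,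
    \<open>x \<le> 2 * y\<^sup>2\<close>, \<open>y \<ge> 1\<close> and \<open>V 0 \<le> ln x\<close>
    for \<open>x > X\<close>.\<close>
  define X where "X = Max {2 * x0, x0 + 1, exp (V 0)}"
  have X: "2 * x0 \<le> X" "x0 + 1 \<le> X" "exp (V 0) \<le> X" by (auto simp: X_def)
  have X_pos: "0 < X" using X(1) x0_pos by linarith
  have lnX: "A \<le> ln X"
    using X(3) V_ge[of 0] X_pos by (metis exp_le_cancel_iff exp_ln order_trans)
  \<comment> \<open>An upper bound of \<open>G\<close> on \<open>{A..ln X}\<close> obtained from
    tangents, so that \<open>exp (- G (ln x))\<close> stays away from 0 on the bounded
    range.\<close>
  define H where "H = G A + max 0 (g (ln X)) * (ln X - A)"
  define K1 where "K1 = sqrt X * exp H"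
  define K2 where "K2 = 2 ^ N * exp (G (V 0))"
  define C where "C = K1 + K2"
  have K1_0: "0 < K1" using X_pos by (simp add: K1_def)
  have K2_0: "0 < K2" by (simp add: K2_def)
  have C0: "0 < C" using K1_0 K2_0 by (simp add: C_def)
  have bound: "sqrt (x - x0) * sinc_inf_prod b (sqrt (x - x0)) \<le> C * exp (- G (ln x))" if x: "x0 < x" for x
  proof -
    define y where "y = sqrt (x - x0)"
    have y0: "0 < y" using x by (simp add: y_def)
    have xpos: "0 < x" using x x0_pos by linarith
    have lnx: "A \<le> ln x" using x x0(2) xpos by (metis exp_le_cancel_iff exp_ln less_imp_le order_trans)
    show ?thesis
    proof (cases "x \<le> X")
      case True
      have lnxX: "ln x \<le> ln X" using True xpos X_pos by simp
      have "G (ln x) \<le> G A + g (ln x) * (ln x - A)"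
        using tangent[OF lnx order_refl] by (simp add: algebra_simps)
      also have "g (ln x) * (ln x - A) \<le> max 0 (g (ln X)) * (ln X - A)"
        using g_mono[OF lnx lnxX] lnx lnxX by (intro mult_mono) auto
      finally have "G (ln x) \<le> H" by (simp add: H_def)
      hence "1 \<le> exp H * exp (- G (ln x))" by (simp add: mult_exp_exp)
      have "y * sinc_inf_prod b y \<le> sqrt X * 1"
      proof (intro mult_mono)
        show "y \<le> sqrt X" using True x0_pos by (simp add: y_def)
        show "sinc_inf_prod b y \<le> 1" using sinc_inf_prod_le[of b y 0] by (simp add: sinc_prod_def)
      qed (use X_pos sinc_inf_prod_nonneg in auto)
      also have "\<dots> \<le> sqrt X * (exp H * exp (- G (ln x)))"
        using \<open>1 \<le> exp H * exp (- G (ln x))\<close> X_pos by (intro mult_left_mono) auto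
      also have "\<dots> \<le> C * exp (- G (ln x))"
        using K2_0 by (simp add: C_def K1_def algebra_simps)
      finally show ?thesis by (simp add: y_def)
    next
      case False
      have y_sq: "y\<^sup>2 = x - x0" using x by (simp add: y_def)
      have y1: "1 \<le> y" using False X(2) by (simp add: y_def)
      have x_le: "x \<le> 2 * y\<^sup>2" using False X(1) y_sq by linarith
      have "exp (V 0) \<le> x" using False X(3) by linarith
      hence u: "V 0 \<le> ln x" using xpos by (metis exp_le_cancel_iff exp_ln)
      then obtain k where k: "V k \<le> ln x" "ln x \<le> V (Suc k)" using ex_V_interval by blast
      have "sinc_inf_prod b y \<le> sinc_prod b (q + Suc k) y" by (rule sinc_inf_prod_le)
      also have "\<dots> \<le> (\<Prod>i<q + Suc k. inverse ((b i * y)\<^sup>2))"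
        using b_pos y0 by (intro sinc_prod_le_prod) auto
      also have "\<dots> = inverse (y ^ (2 * q)) * (\<Prod>j<Suc k. inverse (2 * exp (- V j) * y\<^sup>2))"
        by (rule prod_b)
      also have "\<dots> \<le> inverse (y ^ (2 * q)) * (\<Prod>j<Suc k. exp (V j - ln x))"
      proof (intro mult_left_mono prod_mono conjI)
        fix j
        have "exp (- V j) * x \<le> exp (- V j) * (2 * y\<^sup>2)" using x_le by (intro mult_left_mono) auto
        hence "exp (ln x - V j) \<le> 2 * exp (- V j) * y\<^sup>2"
          using xpos by (simp add: exp_diff exp_minus field_simps)
        hence "inverse (2 * exp (- V j) * y\<^sup>2) \<le> inverse (exp (ln x - V j))"
          by (rule le_imp_inverse_le) simp
        thus "inverse (2 * exp (- V j) * y\<^sup>2) \<le> exp (V j - ln x)" by (simp add: exp_diff field_simps)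
      qed (use y0 in auto)
      also have "(\<Prod>j<Suc k. exp (V j - ln x)) = exp (- K k (ln x))"
        by (simp add: exp_sum[symmetric] K_def sum_negf[symmetric] lessThan_Suc_atMost del: sum_subtractf)
      also have "\<dots> \<le> exp (G (V 0)) * x ^ N * exp (- G (ln x))"
      proof -
        have "x ^ N = exp (real N * ln x)" using xpos by (simp add: exp_of_nat_mult)
        moreover have "0 \<le> real N * V 0" using V_ge[of 0] A_nonneg by simp
        ultimately show ?thesis
          using G_minus_K_bounds[OF k] by (simp add: mult_exp_exp algebra_simps)
      qed
      also have "\<dots> \<le> exp (G (V 0)) * (2 * y\<^sup>2) ^ N * exp (- G (ln x))"
        using x_le xpos by (intro mult_left_mono mult_right_mono power_mono) auto
      finally have "y * sinc_inf_prod b y \<le> y * (inverse (y ^ (2 * q)) * (exp (G (V 0)) * (2 * y\<^sup>2) ^ N * exp (- G (ln x))))"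
        using y0 by (simp add: mult_left_mono)
      also have "\<dots> = inverse y * (K2 * exp (- G (ln x)))"
      proof -
        \<comment> \<open>Of the \<open>q = N + 1\<close> factors with \<open>b i = 1\<close>,
          \<open>N\<close> cancel the power of \<open>x\<close>; the remaining one beats the
          prefactor \<open>y\<close>.\<close>
        have "y ^ (2 * q) = y ^ (2 * N) * (y * y)" by (simp add: q_def)
        moreover have "(2 * y\<^sup>2) ^ N = 2 ^ N * y ^ (2 * N)" by (simp add: power_mult_distrib power_mult)
        ultimately show ?thesis using y0 by (simp only: K2_def) (simp add: field_simps)
      qed
      also have "\<dots> \<le> 1 * (K2 * exp (- G (ln x)))"
        using y1 K2_0 by (intro mult_right_mono) (auto simp: inverse_le_1_iff)
      also have "\<dots> \<le> C * exp (- G (ln x))"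
        using K1_0 by (simp add: C_def)
      finally show ?thesis by (simp add: y_def)
    qed
  qed
  show ?thesis
  proof (rule moment_indeterminate_if_density_ge[OF \<nu> f x0_pos b_pos b_summ, where \<epsilon> = "c / C"])
    show "0 < c / C" using c C0 by simp
    fix x assume x: "x0 < x"
    have "c / C * (sqrt (x - x0) * sinc_inf_prod b (sqrt (x - x0))) \<le> c / C * (C * exp (- G (ln x)))"
      using c C0 bound[OF x] by (intro mult_left_mono) auto
    also have "\<dots> = c * exp (- G (ln x))" using C0 by simp
    also have "\<dots> \<le> f x" using lower x x0(1) by simp
    finally show "c / C * (sqrt (x - x0) * sinc_inf_prod b (sqrt (x - x0))) \<le> f x" .
  qed
qed

lemma finite_integral_G_iff:
  "finite_integral_at_top (\<lambda>u. G u * exp (- u / 2)) \<longleftrightarrow> set_integrable lborel {A..} (\<lambda>u. G u * exp (- u / 2))"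
proof
  assume "finite_integral_at_top (\<lambda>u. G u * exp (- u / 2))"
  then obtain S where S: "A \<le> S" "set_integrable lborel {S..} (\<lambda>u. G u * exp (- u / 2))"
    unfolding finite_integral_at_top_iff[of _ A] by blast
  have cont: "continuous_on {A..} (\<lambda>u. G u * exp (- u / 2))"
    by (intro continuous_intros G_cont) simp
  have "set_integrable lborel {A..S} (\<lambda>u. G u * exp (- u / 2))"
    unfolding set_integrable_def by (intro borel_integrable_compact continuous_on_subset[OF cont]) auto
  moreover have "{A..S} \<union> {S..} = {A..}" using S by auto
  ultimately show "set_integrable lborel {A..} (\<lambda>u. G u * exp (- u / 2))"
    using S set_integrable_Un[of lborel "{A..S}" "\<lambda>u. G u * exp (- u / 2)" "{S..}"] by simp
qed (auto simp: finite_integral_at_top_iff[of _ A])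

text \<open>Replacing \<open>- ln (f (x\<^sup>2))\<close> by \<open>G (2 * ln x)\<close> makes a
  bounded error, integrable against \<open>1 / (1 + x\<^sup>2)\<close>. The substitution
  \<open>x = exp (u / 2)\<close> then turns this weight into one comparable to
  \<open>exp (- u / 2)\<close>.\<close>

lemma set_integrable_log_density_iff:
  assumes f: "f \<in> borel_measurable borel"
    and C: "\<And>x. exp S \<le> x \<Longrightarrow> \<bar>- ln (f (x\<^sup>2)) - G (2 * ln x)\<bar> \<le> C" and S: "A \<le> 2 * S"
  shows "set_integrable lborel {exp S..} (\<lambda>x. - ln (f (x\<^sup>2)) / (1 + x\<^sup>2)) \<longleftrightarrow>
    set_integrable lborel {2 * S..} (\<lambda>u. G u * exp (- u / 2))"
proof -
  define \<phi> where "\<phi> x = - ln (f (x\<^sup>2)) / (1 + x\<^sup>2)" for x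
  define \<psi> where "\<psi> x = G (2 * ln x) / (1 + x\<^sup>2)" for x
  have expS: "0 < x" "A \<le> 2 * ln x" if "exp S \<le> x" for x
  proof -
    show x: "0 < x" using that exp_gt_zero[of S] by linarith
    have "S \<le> ln x" using that x by (metis exp_le_cancel_iff exp_ln)
    thus "A \<le> 2 * ln x" using S by linarith
  qed
  have cont: "continuous_on {exp S..} \<psi>"
  proof -
    have "continuous_on {exp S..} (\<lambda>x. G (2 * ln x))"
      using expS by (intro continuous_on_compose2[OF G_cont] continuous_intros) force+
    thus ?thesis unfolding \<psi>_def
      by (intro continuous_intros) (auto simp: add_nonneg_eq_0_iff)
  qed
  \<comment> \<open>The cutoff makes the function Borel on the whole line, as \<open>G\<close> is
    controlled only on \<open>{A..}\<close>.\<close>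
  define \<psi>' where "\<psi>' x = indicator {exp S..} x * \<psi> x" for x
  have \<psi>'[measurable]: "\<psi>' \<in> borel_measurable borel"
    using borel_measurable_continuous_on_indicator[OF _ cont] by (simp add: \<psi>'_def[abs_def])
  have \<phi>[measurable]: "\<phi> \<in> borel_measurable borel"
    unfolding \<phi>_def using f by measurable
  define \<delta> where "\<delta> x = indicator {exp S..} x * \<phi> x - \<psi>' x" for x
  have \<delta>: "integrable lborel \<delta>"
  proof (rule Bochner_Integration.integrable_bound)
    show "integrable lborel (\<lambda>x::real. C * inverse (1 + x\<^sup>2))"
      using integrable_inverse_1_plus_square by simp
    show "AE x in lborel. norm (\<delta> x) \<le> norm (C * inverse (1 + x\<^sup>2))"
    proof (rule AE_I2)
      fix x
      show "norm (\<delta> x) \<le> norm (C * inverse (1 + x\<^sup>2))"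
      proof (cases "exp S \<le> x")
        case True
        have "\<delta> x = (- ln (f (x\<^sup>2)) - G (2 * ln x)) * inverse (1 + x\<^sup>2)"
          using True by (simp add: \<delta>_def \<phi>_def \<psi>'_def \<psi>_def divide_inverse left_diff_distrib)
        hence "\<bar>\<delta> x\<bar> = \<bar>- ln (f (x\<^sup>2)) - G (2 * ln x)\<bar> * inverse (1 + x\<^sup>2)"
          by (simp add: abs_mult)
        also have "\<dots> \<le> C * inverse (1 + x\<^sup>2)"
          using C[OF True] by (intro mult_right_mono) auto
        finally show ?thesis by simp
      qed (simp add: \<delta>_def \<psi>'_def)
    qed
  qed (unfold \<delta>_def, measurable)
  have image: "{exp S..} = (\<lambda>u. exp (u / 2)) ` {2 * S..}"
  proof (intro equalityI subsetI)
    fix x assume "x \<in> {exp S..}"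
    hence x: "exp S \<le> x" by simp
    have "S \<le> ln x" using x expS(1)[OF x] by (metis exp_le_cancel_iff exp_ln)
    thus "x \<in> (\<lambda>u. exp (u / 2)) ` {2 * S..}"
      using expS(1)[OF x] by (intro image_eqI[of _ _ "2 * ln x"]) auto
  qed auto
  have "set_integrable lborel {exp S..} \<phi> \<longleftrightarrow> integrable lborel (\<lambda>x. indicator {exp S..} x * \<phi> x)"
    by (simp add: set_integrable_def)
  also have "\<dots> \<longleftrightarrow> integrable lborel \<psi>'"
  proof
    assume "integrable lborel (\<lambda>x. indicator {exp S..} x * \<phi> x)"
    from Bochner_Integration.integrable_diff[OF this \<delta>] show "integrable lborel \<psi>'"
      by (simp add: \<delta>_def)
  next
    assume "integrable lborel \<psi>'"
    from Bochner_Integration.integrable_add[OF \<delta> this] show "integrable lborel (\<lambda>x. indicator {exp S..} x * \<phi> x)"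
      by (simp add: \<delta>_def)
  qed
  also have "\<dots> \<longleftrightarrow> set_integrable lborel {exp S..} \<psi>'"
  proof -
    have "indicator {exp S..} x *\<^sub>R \<psi>' x = \<psi>' x" for x by (simp add: \<psi>'_def indicator_def)
    thus ?thesis by (simp only: set_integrable_def)
  qed
  also have "\<dots> \<longleftrightarrow> \<psi>' absolutely_integrable_on {exp S..}"
    by (subst borel_absolutely_integrable_iff) auto
  also have "\<dots> \<longleftrightarrow> \<psi>' absolutely_integrable_on (\<lambda>u. exp (u / 2)) ` {2 * S..}"
    by (simp only: image)
  also have "\<dots> \<longleftrightarrow>
      (\<lambda>u. \<bar>exp (u / 2) / 2\<bar> * \<psi>' (exp (u / 2))) absolutely_integrable_on {2 * S..}"
  proof -
    have der: "((\<lambda>u. exp (u / 2)) has_real_derivative exp (u / 2) / 2) (at u within {2 * S..})" for u :: real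
      by (auto intro!: derivative_eq_intros)
    have inj: "inj_on (\<lambda>u::real. exp (u / 2)) {2 * S..}" and leb: "{2 * S..} \<in> sets lebesgue"
      by (auto simp: inj_on_def)
    \<comment> \<open>The theorem couples integrability with a prescribed value of the integral;
      prescribing the integral of either side in turn leaves the equivalence of integrability
      alone.\<close>
    note * = has_absolute_integral_change_of_variables_1'[OF leb der inj, of "\<psi>'"]
    show ?thesis
      using *[of "integral {2 * S..} (\<lambda>u. \<bar>exp (u / 2) / 2\<bar> * \<psi>' (exp (u / 2)))"]
        *[of "integral ((\<lambda>u. exp (u / 2)) ` {2 * S..}) \<psi>'"]
      by blast
  qed
  also have "\<dots> \<longleftrightarrow> set_integrable lborel {2 * S..} (\<lambda>u. \<bar>exp (u / 2) / 2\<bar> * \<psi>' (exp (u / 2)))"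
    by (rule borel_absolutely_integrable_iff) measurable
  also have "\<dots> \<longleftrightarrow> set_integrable lborel {2 * S..} (\<lambda>u. G u * exp (- u / 2))"
  proof -
    define \<eta> where "\<eta> u = \<bar>exp (u / 2) / 2\<bar> * \<psi>' (exp (u / 2))" for u
    have \<eta>[measurable]: "\<eta> \<in> borel_measurable borel" unfolding \<eta>_def by measurable
    have G0: "0 \<le> G u" if "2 * S \<le> u" for u using that S G_nonneg by simp
    have ident: "\<eta> u = G u * exp (- u / 2) * (exp u / (2 * (1 + exp u)))" if "2 * S \<le> u" for u
    proof -
      have "exp S \<le> exp (u / 2)" using that by simp
      hence "\<eta> u = exp (u / 2) / 2 * (G u / (1 + exp u))"
        by (simp add: \<eta>_def \<psi>'_def \<psi>_def exp_double[symmetric])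
      also have "exp (u / 2) = exp (- u / 2) * exp u" by (simp add: mult_exp_exp)
      finally show ?thesis by (simp add: field_simps)
    qed
    have Gm: "(\<lambda>u. indicator {2 * S..} u * (G u * exp (- u / 2))) \<in> borel_measurable borel"
    proof -
      have "(\<lambda>u. indicator {2 * S..} u * (G u * exp (- u / 2))) = (\<lambda>u. indicator {2 * S..} u * (indicator {A..} u * (G u * exp (- u / 2))))"
        using S by (auto simp: indicator_def fun_eq_iff)
      thus ?thesis using indicator_G_measurable by simp
    qed
    have "set_integrable lborel {2 * S..} \<eta> \<longleftrightarrow> set_integrable lborel {2 * S..} (\<lambda>u. G u * exp (- u / 2))"
    proof
      assume *: "set_integrable lborel {2 * S..} \<eta>"
      show "set_integrable lborel {2 * S..} (\<lambda>u. G u * exp (- u / 2))"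
      proof -
        \<comment> \<open>The quotient \<open>exp u / (2 * (1 + exp u))\<close> increases with
          \<open>u\<close>, so its value at the left end point bounds it from below.\<close>
        define m where "m = exp (2 * S) / (2 * (1 + exp (2 * S)))"
        have m0: "0 < m" by (simp add: m_def add_pos_pos)
        have "integrable lborel (\<lambda>u. indicator {2 * S..} u * (G u * exp (- u / 2)))"
        proof (rule Bochner_Integration.integrable_bound)
          show "integrable lborel (\<lambda>u. inverse m * (indicator {2 * S..} u * \<eta> u))"
            using * by (simp add: set_integrable_def)
          show "AE u in lborel. norm (indicator {2 * S..} u * (G u * exp (- u / 2))) \<le> norm (inverse m * (indicator {2 * S..} u * \<eta> u))"
          proof (rule AE_I2)
            fix u
            show "norm (indicator {2 * S..} u * (G u * exp (- u / 2))) \<le> norm (inverse m * (indicator {2 * S..} u * \<eta> u))"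
            proof (cases "2 * S \<le> u")
              case True
              have "m \<le> exp u / (2 * (1 + exp u))"
                using True by (simp add: m_def divide_simps add_pos_pos) (simp add: algebra_simps)
              hence "m * (G u * exp (- u / 2)) \<le> \<eta> u"
                unfolding ident[OF True] using G0[OF True] by (subst mult.commute) (intro mult_left_mono, auto)
              hence "G u * exp (- u / 2) \<le> inverse m * \<eta> u"
                using m0 by (simp add: field_simps)
              thus ?thesis using True G0[OF True] m0 by simp
            qed simp
          qed
        qed (use Gm in simp)
        thus ?thesis by (simp add: set_integrable_def)
      qed
    next
      assume *: "set_integrable lborel {2 * S..} (\<lambda>u. G u * exp (- u / 2))"
      have "integrable lborel (\<lambda>u. indicator {2 * S..} u * \<eta> u)"
      proof (rule Bochner_Integration.integrable_bound)
        show "integrable lborel (\<lambda>u. indicator {2 * S..} u * (G u * exp (- u / 2)))"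
          using * by (simp add: set_integrable_def)
        show "AE u in lborel. norm (indicator {2 * S..} u * \<eta> u) \<le> norm (indicator {2 * S..} u * (G u * exp (- u / 2)))"
        proof (rule AE_I2)
          fix u
          show "norm (indicator {2 * S..} u * \<eta> u) \<le> norm (indicator {2 * S..} u * (G u * exp (- u / 2)))"
          proof (cases "2 * S \<le> u")
            case True
            have "exp u / (2 * (1 + exp u)) \<le> 1" "0 \<le> exp u / (2 * (1 + exp u))"
              by (auto simp: divide_simps add_pos_pos)
            hence "\<bar>\<eta> u\<bar> \<le> G u * exp (- u / 2) * 1"
              unfolding ident[OF True] abs_mult using G0[OF True] by (intro mult_mono) auto
            thus ?thesis using True G0[OF True] by simp
          qed simp
        qed
      qed measurable
      thus "set_integrable lborel {2 * S..} \<eta>" by (simp add: set_integrable_def)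
    qed
    thus ?thesis by (simp only: \<eta>_def[abs_def])
  qed
  finally show ?thesis by (simp only: \<phi>_def[abs_def])
qed

lemma finite_integral_log_density_iff:
  assumes f: "f \<in> borel_measurable borel" and c: "0 < c1" "0 < c2"
    and bounds: "\<And>x. x1 \<le> x \<Longrightarrow> c1 * exp (- G (ln x)) \<le> f x" "\<And>x. x1 \<le> x \<Longrightarrow> f x \<le> c2 * exp (- G (ln x))"
  shows "finite_integral_at_top (\<lambda>x. - ln (f (x\<^sup>2)) / (1 + x\<^sup>2)) \<longleftrightarrow>
    finite_integral_at_top (\<lambda>u. G u * exp (- u / 2))"
proof -
  \<comment> \<open>As \<open>A \<ge> 0\<close>, \<open>x \<ge> exp S0\<close> implies
    \<open>x \<ge> 1\<close>, hence \<open>x\<^sup>2 \<ge> x \<ge> x1\<close>, and the density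
    bounds apply at \<open>x\<^sup>2\<close>.\<close>
  define S0 where "S0 = max A (ln (max 1 x1))"
  have S0: "0 \<le> S0" "A \<le> S0" using A_nonneg by (auto simp: S0_def)
  have close: "\<bar>- ln (f (x\<^sup>2)) - G (2 * ln x)\<bar> \<le> \<bar>ln c1\<bar> + \<bar>ln c2\<bar>" if x: "exp S0 \<le> x" for x
  proof -
    have xpos: "1 \<le> x" using x S0(1) by (meson one_le_exp_iff order_trans)
    have "x1 \<le> exp (ln (max 1 x1))" by simp
    also have "\<dots> \<le> exp S0" unfolding S0_def by (intro iffD2[OF exp_le_cancel_iff]) simp
    also have "\<dots> \<le> x * 1" using x by simp
    also have "x * 1 \<le> x * x" using xpos by (intro mult_left_mono) auto
    finally have x1: "x1 \<le> x\<^sup>2" by (simp add: power2_eq_square)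
    have ln_sq: "ln (x\<^sup>2) = 2 * ln x" using xpos by (simp add: ln_realpow)
    have f_pos: "0 < f (x\<^sup>2)" using bounds(1)[OF x1] c(1) by (smt (verit) exp_gt_zero mult_pos_pos)
    have "ln (c1 * exp (- G (2 * ln x))) \<le> ln (f (x\<^sup>2))"
      using bounds(1)[OF x1] c(1) f_pos by (simp add: ln_sq)
    moreover have "ln (f (x\<^sup>2)) \<le> ln (c2 * exp (- G (2 * ln x)))"
      using bounds(2)[OF x1] c(2) f_pos by (simp add: ln_sq)
    ultimately show ?thesis using c by (simp add: ln_mult)
  qed
  have iff: "set_integrable lborel {exp S..} (\<lambda>x. - ln (f (x\<^sup>2)) / (1 + x\<^sup>2)) \<longleftrightarrow>
    set_integrable lborel {2 * S..} (\<lambda>u. G u * exp (- u / 2))" if "S0 \<le> S" for S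
  proof (rule set_integrable_log_density_iff[OF f])
    show "A \<le> 2 * S" using that S0 by linarith
    fix x assume "exp S \<le> x"
    hence "exp S0 \<le> x" using that by (meson exp_le_cancel_iff order_trans)
    thus "\<bar>- ln (f (x\<^sup>2)) - G (2 * ln x)\<bar> \<le> \<bar>ln c1\<bar> + \<bar>ln c2\<bar>" by (rule close)
  qed
  have "finite_integral_at_top (\<lambda>x. - ln (f (x\<^sup>2)) / (1 + x\<^sup>2)) \<longleftrightarrow>
      (\<exists>S\<ge>S0. set_integrable lborel {exp S..} (\<lambda>x. - ln (f (x\<^sup>2)) / (1 + x\<^sup>2)))"
  proof -
    have *: "(\<exists>X\<ge>exp S0. P X) \<longleftrightarrow> (\<exists>S\<ge>S0. P (exp S))" for P :: "real \<Rightarrow> bool"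
    proof
      assume "\<exists>X\<ge>exp S0. P X"
      then obtain X where X: "exp S0 \<le> X" "P X" by blast
      have "0 < X" using X(1) exp_gt_zero[of S0] by linarith
      thus "\<exists>S\<ge>S0. P (exp S)" using X by (intro exI[of _ "ln X"]) (auto simp: ln_ge_iff)
    qed auto
    show ?thesis by (simp only: finite_integral_at_top_iff[of _ "exp S0"] *)
  qed
  also have "\<dots> \<longleftrightarrow> (\<exists>S\<ge>S0. set_integrable lborel {2 * S..} (\<lambda>u. G u * exp (- u / 2)))"
    using iff by (intro ex_cong) simp
  also have "\<dots> \<longleftrightarrow> (\<exists>U\<ge>2 * S0. set_integrable lborel {U..} (\<lambda>u. G u * exp (- u / 2)))"
  proof -
    have *: "(\<exists>U\<ge>2 * S0. P U) \<longleftrightarrow> (\<exists>S\<ge>S0. P (2 * S))" for P :: "real \<Rightarrow> bool"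
    proof
      assume "\<exists>U\<ge>2 * S0. P U"
      then obtain U where "2 * S0 \<le> U" "P U" by blast
      thus "\<exists>S\<ge>S0. P (2 * S)" by (intro exI[of _ "U / 2"]) auto
    next
      assume "\<exists>S\<ge>S0. P (2 * S)"
      then obtain S where "S0 \<le> S" "P (2 * S)" by blast
      thus "\<exists>U\<ge>2 * S0. P U" by (intro exI[of _ "2 * S"]) auto
    qed
    show ?thesis by (simp only: *)
  qed
  also have "\<dots> \<longleftrightarrow> finite_integral_at_top (\<lambda>u. G u * exp (- u / 2))"
    by (rule finite_integral_at_top_iff[symmetric])
  finally show ?thesis .
qed

end

section \<open>Admissible functions and the conclusion\<close>

lemma admissible_convex_legendre:
  assumes "admissible_parabolic a G"
  shows "\<exists>A N. convex_legendre G (deriv G) (deriv_inverse a G) A N"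
proof -
  define g where "g = deriv G"
  have a: "a < \<infinity>" and G: "\<And>x. x \<in> ray a \<Longrightarrow> G differentiable at x" "\<And>x. x \<in> ray a \<Longrightarrow> g differentiable at x"
    "\<And>x. x \<in> ray a \<Longrightarrow> 0 < deriv g x" and lim: "filterlim (\<lambda>x. G x / x) at_top at_top"
    using assms by (auto simp: admissible_parabolic_def asymptotically_parabolic_def C2_plus_def g_def)
  have up: "y \<in> ray a" if "x \<in> ray a" "x \<le> y" for x y
    using that less_le_trans[of a "ereal x" "ereal y"] by (auto simp: ray_def)
  have dG: "(G has_real_derivative g x) (at x)" if "x \<in> ray a" for x
    unfolding g_def using G(1)[OF that] by (simp add: DERIV_deriv_iff_real_differentiable)
  have dg: "(g has_real_derivative deriv g x) (at x)" if "x \<in> ray a" for x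
    using G(2)[OF that] by (simp add: DERIV_deriv_iff_real_differentiable)
  have g_strict: "g u < g w" if "u \<in> ray a" "u < w" for u w
    using that up[OF that(1)] G(3) dg by (intro DERIV_pos_imp_increasing[of u w g]) blast+
  have g_mono: "g u \<le> g w" if "u \<in> ray a" "u \<le> w" for u w
    using g_strict[of u w] that by (cases "u = w") auto
  have tangent: "G u + g u * (w - u) \<le> G w" if uw: "u \<in> ray a" "w \<in> ray a" for u w
  proof (cases u w rule: linorder_cases)
    case less
    then obtain z where z: "u < z" "z < w" "G w - G u = (w - u) * g z"
      using MVT2[of u w G g] dG up[OF uw(1)] by blast
    have "(w - u) * g u \<le> (w - u) * g z"
      using z uw by (intro mult_left_mono g_mono) auto
    thus ?thesis using z by (simp add: algebra_simps)
  next
    case greater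
    then obtain z where z: "w < z" "z < u" "G u - G w = (u - w) * g z"
      using MVT2[of w u G g] dG up[OF uw(2)] by blast
    have "(u - w) * g z \<le> (u - w) * g u"
      using z uw up[OF uw(2), of z] by (intro mult_left_mono g_mono) auto
    thus ?thesis using z by (simp add: algebra_simps)
  qed simp
  obtain r where r: "r \<in> ray a"
    using a by (cases a) (auto simp: ray_def intro: that[of "real_of_ereal a + 1"] that[of 0])
  obtain R where R: "\<And>x. R \<le> x \<Longrightarrow> 0 \<le> G x / x"
    using filterlim_at_top[THEN iffD1, OF lim, rule_format, of 0] by (auto simp: eventually_at_top_linorder)
  define A where "A = Max {0, r, R}"
  have A: "0 \<le> A" "r \<le> A" "R \<le> A" by (auto simp: A_def)
  have A_ray: "A \<le> u \<Longrightarrow> u \<in> ray a" for u using up[OF r] A(2) by simp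
  have G_nonneg: "0 \<le> G u" if "A < u" for u
    using R[of u] that A by (simp add: zero_le_divide_iff)
  \<comment> \<open>At \<open>u = 0\<close> the quotient \<open>G u / u\<close> is 0 by convention
    and says nothing about the sign of \<open>G\<close>; moving beyond \<open>A \<ge> 0\<close>
    avoids this point.\<close>
  define A' where "A' = A + 1"
  have A': "A < A'" "0 \<le> A'" using A by (auto simp: A'_def)
  have A'_ray: "A' \<le> u \<Longrightarrow> u \<in> ray a" for u using A_ray A' by simp
  have surj: "\<exists>u\<ge>A'. g u = s" if s: "g A' \<le> s" for s
  proof -
    \<comment> \<open>Superlinear growth enters here: if \<open>g\<close> stayed below
      \<open>s\<close>, the tangent inequality would bound \<open>G w / w\<close>.\<close>
    have "\<exists>w\<ge>A'. s \<le> g w"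
    proof (rule ccontr)
      assume "\<not> ?thesis"
      hence g_le: "g w \<le> s" if "A' \<le> w" for w using that by force
      have "\<forall>\<^sub>F w in at_top. G w / w < \<bar>s\<bar> + 1 + \<bar>G A'\<bar>"
        using eventually_ge_at_top[of "max 1 A'"]
      proof eventually_elim
        case (elim w)
        hence w: "A' \<le> w" "1 \<le> w" by auto
        have "G w \<le> G A' + g w * (w - A')"
          using tangent[of w A'] A'_ray w by (simp add: algebra_simps)
        also have "g w * (w - A') \<le> \<bar>s\<bar> * w"
          using g_le[OF w(1)] w A' by (intro mult_mono) auto
        also have "G A' + \<bar>s\<bar> * w \<le> \<bar>G A'\<bar> * w + \<bar>s\<bar> * w"
          using w mult_left_mono[of 1 w "\<bar>G A'\<bar>"] by simp
        also have "\<dots> < (\<bar>s\<bar> + 1 + \<bar>G A'\<bar>) * w" using w by (simp add: algebra_simps)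
        finally show ?case using w by (simp add: divide_less_eq)
      qed
      moreover have "\<forall>\<^sub>F w in at_top. \<bar>s\<bar> + 1 + \<bar>G A'\<bar> \<le> G w / w"
        using lim by (simp add: filterlim_at_top)
      ultimately have "\<forall>\<^sub>F w::real in at_top. False" by eventually_elim simp
      thus False by simp
    qed
    then obtain w where w: "A' \<le> w" "s \<le> g w" by blast
    have "\<exists>u\<ge>A'. u \<le> w \<and> g u = s"
      using s w DERIV_isCont[OF dg] A'_ray by (intro IVT) auto
    thus ?thesis by blast
  qed
  have inj: "inj_on g (ray a)"
    using g_strict by (intro inj_onI) (metis linorder_neqE less_irrefl)
  obtain N :: nat where N: "max 2 (g A') \<le> real N" using real_arch_simple by blast
  \<comment> \<open>From \<open>g A'\<close> on every slope is attained in \<open>{A'..}\<close>;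
    injectivity of \<open>g\<close> on the whole ray identifies that point with the value of
    \<open>deriv_inverse\<close>.\<close>
  have v: "A' \<le> deriv_inverse a G s \<and> g (deriv_inverse a G s) = s" if s: "real N \<le> s" for s
  proof -
    obtain u where u: "A' \<le> u" "g u = s" using surj[of s] order_trans[of "g A'" "real N" s] s N by auto
    have "deriv_inverse a G s = u"
      unfolding deriv_inverse_def u(2)[symmetric] using the_inv_into_f_f[OF inj A'_ray[OF u(1)]] by (simp add: g_def)
    thus ?thesis using u by simp
  qed
  have "convex_legendre G g (deriv_inverse a G) A' N"
  proof
    show "continuous_on {A'..} G"
      using DERIV_isCont[OF dG] A'_ray by (intro continuous_at_imp_continuous_on) auto
    show "G u + g u * (w - u) \<le> G w" if "A' \<le> u" "A' \<le> w" for u w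
      by (rule tangent[OF A'_ray A'_ray]) (use that in auto)
    show "g u < g w" if "A' \<le> u" "u < w" for u w
      by (rule g_strict[OF A'_ray]) (use that in auto)
  qed (use A' N G_nonneg v in auto)
  thus ?thesis unfolding g_def by blast
qed

theorem theorem1p2:
  fixes \<nu> :: "real measure" and a :: ereal and G :: "real \<Rightarrow> real"
  assumes "prob_space \<nu>"
    and "half_line_measure \<nu>"
    and "\<not> bounded (measure_support \<nu>)"
    and "finite_moments \<nu>"
    and "admissible_parabolic a G"
    and "measure_tail \<nu> \<in> O[at_top](\<lambda>x. exp (- G (ln x))) \<or>
         (\<exists>f. is_density \<nu> f \<and> f \<in> O[at_top](\<lambda>x. exp (- G (ln x))))"
  shows "(\<not> finite_sum_at_top (\<lambda>n. exp (- (1/2) * deriv_inverse a G (real n)))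
            \<longrightarrow> moment_determinate \<nu>) \<and>
         (\<forall>f. is_density \<nu> f \<and> f \<in> \<Theta>[at_top](\<lambda>x. exp (- G (ln x))) \<and>
              (\<exists>L::real. ((\<lambda>x. deriv G x * exp (- x / 2)) \<longlongrightarrow> L) at_top) \<longrightarrow>
            (moment_indeterminate \<nu> \<longleftrightarrow>
               finite_sum_at_top (\<lambda>n. exp (- (1/2) * deriv_inverse a G (real n)))) \<and>
            (moment_indeterminate \<nu> \<longleftrightarrow>
               finite_integral_at_top (\<lambda>x. G x * exp (- x / 2))) \<and>
            (moment_indeterminate \<nu> \<longleftrightarrow>
               finite_integral_at_top (\<lambda>x. - ln (f (x\<^sup>2)) / (1 + x\<^sup>2))))"
proof -
  note \<nu> = assms(1,2,4)
  obtain A N where "convex_legendre G (deriv G) (deriv_inverse a G) A N"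
    using admissible_convex_legendre[OF assms(5)] by blast
  then interpret convex_legendre G "deriv G" "deriv_inverse a G" A N .
  have sum_iff: "finite_sum_at_top (\<lambda>n. exp (- (1/2) * deriv_inverse a G (real n))) \<longleftrightarrow>
      summable (\<lambda>j. exp (- (1/2) * V j))"
    unfolding V_def by (rule finite_sum_at_top_iff)
  have determinate: "moment_determinate \<nu>"
    if "\<not> finite_sum_at_top (\<lambda>n. exp (- (1/2) * deriv_inverse a G (real n)))"
  proof -
    obtain C where C: "0 \<le> C" "\<And>n::nat. (\<integral>x. x ^ n \<partial>\<nu>) \<le> C * exp (real n) * exp (L (real n + real N))"
      using assms(6) tail_moments_le[OF \<nu>] density_moments_le[OF \<nu>] by blast
    show ?thesis
    proof (rule determinate_if_moments_le[OF \<nu> C])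
      show "\<not> summable (\<lambda>n. exp (- (1/2) * deriv_inverse a G (real n + real N + 2)))"
        using that unfolding finite_sum_at_top_iff[of _ "N + 2"]
        by (simp only: of_nat_add of_nat_numeral add.assoc not_False_eq_True)
    qed
  qed
  have equivalences: "(moment_indeterminate \<nu> \<longleftrightarrow> finite_sum_at_top (\<lambda>n. exp (- (1/2) * deriv_inverse a G (real n)))) \<and>
      (moment_indeterminate \<nu> \<longleftrightarrow> finite_integral_at_top (\<lambda>x. G x * exp (- x / 2))) \<and>
      (moment_indeterminate \<nu> \<longleftrightarrow> finite_integral_at_top (\<lambda>x. - ln (f (x\<^sup>2)) / (1 + x\<^sup>2)))"
    if f: "is_density \<nu> f" "f \<in> \<Theta>[at_top](\<lambda>x. exp (- G (ln x)))" for f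
  proof -
    have f0: "\<And>x. 0 \<le> f x" and fm: "f \<in> borel_measurable borel"
      using f(1) by (auto simp: is_density_def)
    obtain c1 where c1: "0 < c1" "\<forall>\<^sub>F x in at_top. c1 * exp (- G (ln x)) \<le> f x"
      using bigthetaD2[OF f(2)] f0 by (auto elim!: landau_omega.bigE)
    obtain c2 where c2: "0 < c2" "\<forall>\<^sub>F x in at_top. f x \<le> c2 * exp (- G (ln x))"
      using bigthetaD1[OF f(2)] f0 by (auto elim!: landau_o.bigE)
    obtain x1 where x1: "\<And>x. x1 \<le> x \<Longrightarrow> c1 * exp (- G (ln x)) \<le> f x" "\<And>x. x1 \<le> x \<Longrightarrow> f x \<le> c2 * exp (- G (ln x))"
      using eventually_conj[OF c1(2) c2(2)] by (auto simp: eventually_at_top_linorder)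
    \<comment> \<open>Divergence gives determinacy by the first part and convergence gives
      indeterminacy by the perturbation; the integrals are tied to the series independently of the
      moment problem.\<close>
    have "moment_indeterminate \<nu> \<longleftrightarrow> summable (\<lambda>j. exp (- (1/2) * V j))"
      using determinate indeterminate_if_summable[OF \<nu>(2,3) f(1) c1(1) x1(1)]
      unfolding moment_indeterminate_def sum_iff by blast
    thus ?thesis
      using sum_iff summable_iff_integrable finite_integral_G_iff
        finite_integral_log_density_iff[OF fm c1(1) c2(1) x1] by simp
  qed
  show ?thesis using determinate equivalences by blast
qed

end
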